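(* For $k=1,\dots,n$ let $\{T_{k,w}\}_{w\in\Omega}\subset End_{\mathcal A}^{*}(\mathcal H)$ be a continuous operator frame for $End_{\mathcal A}^{*}(\mathcal H)$ with bounds $A_k$ and $B_k$, and let $\alpha_1,\dots,\alpha_n$ be any scalars. If there exist a constant $\lambda>0$ and some $p\in\{1,\dots,n\}$ such that $$\lambda\,\big\|\{T_{p,w}x\}_{w\in\Omega}\big\|\le\Big\|\Big\{\sum_{k=1}^n\alpha_kT_{k,w}x\Big\}_{w\in\Omega}\Big\|,\qquad x\in\mathcal H,$$ then $\{\sum_{k=1}^n\alpha_kT_{k,w}\}_{w\in\Omega}$ is a continuous operator frame for $End_{\mathcal A}^{*}(\mathcal H)$. Conversely, if $\{\sum_{k=1}^n\alpha_kT_{k,w}\}_{w\in\Omega}$ is a continuous operator frame for $End_{\mathcal A}^{*}(\mathcal H)$, then there exist a constant $\lambda>0$ and some $p\in\{1,\dots,n\}$ such that the displayed inequality holds for all $x\in\mathcal H$.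
   Context: $\mathcal A$ is a unital $C^*$-algebra, $\mathcal H$ is a (left) Hilbert $\mathcal A$-module with $\mathcal A$-valued inner product $\langle\cdot,\cdot\rangle_{\mathcal A}$ ($\mathcal A$-linear in the first variable) and norm $\|x\|=\|\langle x,x\rangle_{\mathcal A}\|^{1/2}$, and $End_{\mathcal A}^{*}(\mathcal H)$ is the set of adjointable operators $\mathcal H\to\mathcal H$. $(\Omega,\mu)$ is a measure space; integrals of Banach-space-valued functions are Bochner integrals. Inequalities between elements of $\mathcal A$ refer to the order given by the positive cone $\mathcal A^+$. Scalars are complex numbers. For a family $\{x_w\}_{w\in\Omega}$ in $\mathcal H$ write $\|\{x_w\}_{w\in\Omega}\|=\big\|\int_\Omega\langle x_w,x_w\rangle_{\mathcal A}\,d\mu(w)\big\|^{1/2}$. A family $\{\Lambda_w\}_{w\in\Omega}\subset End_{\mathcal A}^{*}(\mathcal H)$ is a continuous operator frame for $End_{\mathcal A}^{*}(\mathcal H)$ with bounds $A,B>0$ if (a) for every $x\in\mathcal H$ the map $w\mapsto\Lambda_w x$ is measurable, and (b) for every $x\in\mathcal H$, $A\langle x,x\rangle_{\mathcal A}\le\int_\Omega\langle\Lambda_w x,\Lambda_w x\rangle_{\mathcal A}\,d\mu(w)\le B\langle x,x\rangle_{\mathcal A}$. It is called a continuous operator frame if such $A,B>0$ exist. *)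

theory Defs
  imports "HOL-Analysis.Analysis"
begin

section \<open>Unital $C^*$-algebras\<close>

text \<open>The superclass \<^class>\<open>real_normed_algebra_1\<close> makes the unit nonzero.\<close>

class cstar_algebra = banach + real_normed_algebra_1 +
  fixes scaleC :: "complex \<Rightarrow> 'a \<Rightarrow> 'a"
    and star :: "'a \<Rightarrow> 'a"
  assumes scaleC_add_right: "scaleC c (a + b) = scaleC c a + scaleC c b"
    and scaleC_add_left: "scaleC (c + d) a = scaleC c a + scaleC d a"
    and scaleC_scaleC: "scaleC c (scaleC d a) = scaleC (c * d) a"
    and scaleC_of_real: "scaleC (complex_of_real r) a = scaleR r a"
    and mult_scaleC_left: "scaleC c a * b = scaleC c (a * b)"
    and mult_scaleC_right: "a * scaleC c b = scaleC c (a * b)"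
    and norm_scaleC: "norm (scaleC c a) = cmod c * norm a"
    and star_add: "star (a + b) = star a + star b"
    and star_scaleC: "star (scaleC c a) = scaleC (cnj c) (star a)"
    and star_mult: "star (a * b) = star b * star a"
    and star_star: "star (star a) = a"
    and cstar_identity: "norm (star a * a) = (norm a)\<^sup>2"

definition cstar_spectrum :: "'a::cstar_algebra \<Rightarrow> complex set" where
  "cstar_spectrum a =
     {z. \<not> (\<exists>b. b * (a - scaleC z 1) = 1 \<and> (a - scaleC z 1) * b = 1)}"

definition cstar_positive :: "'a::cstar_algebra \<Rightarrow> bool" where
  "cstar_positive a \<longleftrightarrow> star a = a \<and> cstar_spectrum a \<subseteq> \<real>\<^sub>\<ge>\<^sub>0"

definition cstar_le :: "'a::cstar_algebra \<Rightarrow> 'a \<Rightarrow> bool"  (infix \<open>\<sqsubseteq>\<close> 50) where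
  "a \<sqsubseteq> b \<longleftrightarrow> cstar_positive (b - a)"


section \<open>Hilbert modules\<close>

text \<open>
  Left Hilbert modules: \<open>sm\<close> is the module action and \<open>ip\<close> the algebra-valued inner product.
  Norm and completeness come from the class \<^class>\<open>banach\<close>, where the norm is required to be the one
  induced by \<open>ip\<close>, and the real scalar multiplication is the one induced by \<open>sm\<close>.
\<close>

locale hilbert_module =
  fixes sm :: "'a::cstar_algebra \<Rightarrow> 'h::banach \<Rightarrow> 'h"
    and ip :: "'h \<Rightarrow> 'h \<Rightarrow> 'a"
  assumes sm_add_right: "sm a (x + y) = sm a x + sm a y"
    and sm_add_left: "sm (a + b) x = sm a x + sm b x"
    and sm_sm: "sm a (sm b x) = sm (a * b) x"
    and sm_one: "sm 1 x = x"
    and sm_scaleR: "sm (scaleR r a) x = scaleR r (sm a x)"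
    and ip_add_left: "ip (x + y) z = ip x z + ip y z"
    and ip_sm_left: "ip (sm a x) y = a * ip x y"
    and ip_star: "star (ip x y) = ip y x"
    and ip_positive: "cstar_positive (ip x x)"
    and ip_definite: "ip x x = 0 \<Longrightarrow> x = 0"
    and norm_eq_ip: "norm x = sqrt (norm (ip x x))"

text \<open>A module over a unital algebra has exactly one compatible complex vector space structure.\<close>

definition module_scaleC :: "('a::cstar_algebra \<Rightarrow> 'h \<Rightarrow> 'h) \<Rightarrow> complex \<Rightarrow> 'h \<Rightarrow> 'h" where
  "module_scaleC sm c x = sm (scaleC c 1) x"

text \<open>Adjointability already implies that the map is module linear and bounded.\<close>

definition adjointable :: "('h \<Rightarrow> 'h \<Rightarrow> 'a) \<Rightarrow> ('h \<Rightarrow> 'h) \<Rightarrow> bool" where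
  "adjointable ip S \<longleftrightarrow> (\<exists>S'. \<forall>x y. ip (S x) y = ip x (S' y))"


section \<open>The Bochner integral without separability of the range space\<close>

text \<open>
  \<^const>\<open>has_bochner_integral\<close> needs a second countable range type. The following is the same
  definition, with Borel measurability replaced by strong measurability; the two agree where both
  make sense (see below).
\<close>

definition strongly_measurable :: "'w measure \<Rightarrow> ('w \<Rightarrow> 'b::real_normed_vector) \<Rightarrow> bool" where
  "strongly_measurable M f \<longleftrightarrow>
     (\<exists>s. (\<forall>i. simple_function M (s i)) \<and> (\<forall>w\<in>space M. (\<lambda>i. s i w) \<longlonglongrightarrow> f w))"

definition has_strong_integral ::
    "'w measure \<Rightarrow> ('w \<Rightarrow> 'b::real_normed_vector) \<Rightarrow> 'b \<Rightarrow> bool" where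
  "has_strong_integral M f I \<longleftrightarrow>
     strongly_measurable M f \<and>
     (\<exists>s. (\<forall>i. Bochner_Integration.simple_bochner_integrable M (s i)) \<and>
          (\<lambda>i. \<integral>\<^sup>+w. norm (f w - s i w) \<partial>M) \<longlonglongrightarrow> 0 \<and>
          (\<lambda>i. Bochner_Integration.simple_bochner_integral M (s i)) \<longlonglongrightarrow> I)"

definition strong_integrable :: "'w measure \<Rightarrow> ('w \<Rightarrow> 'b::real_normed_vector) \<Rightarrow> bool" where
  "strong_integrable M f \<longleftrightarrow> (\<exists>I. has_strong_integral M f I)"

definition strong_integral :: "'w measure \<Rightarrow> ('w \<Rightarrow> 'b::real_normed_vector) \<Rightarrow> 'b" where
  "strong_integral M f =
     (if strong_integrable M f then THE I. has_strong_integral M f I else 0)"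

lemma strongly_measurable_iff_borel_measurable:
  fixes f :: "'w \<Rightarrow> 'b::{real_normed_vector, second_countable_topology}"
  shows "strongly_measurable M f \<longleftrightarrow> f \<in> borel_measurable M"
proof
  assume "strongly_measurable M f"
  then obtain s where "\<And>i. simple_function M (s i)"
    and "\<And>w. w \<in> space M \<Longrightarrow> (\<lambda>i. s i w) \<longlonglongrightarrow> f w"
    unfolding strongly_measurable_def by blast
  then show "f \<in> borel_measurable M"
    using borel_measurable_LIMSEQ_metric[of s M f] borel_measurable_simple_function by blast
next
  assume "f \<in> borel_measurable M"
  from borel_measurable_implies_sequence_metric[OF this, of 0]
  show "strongly_measurable M f"
    unfolding strongly_measurable_def by blast
qed

lemma has_strong_integral_iff_has_bochner_integral:
  fixes f :: "'w \<Rightarrow> 'b::{real_normed_vector, second_countable_topology}"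
  shows "has_strong_integral M f I \<longleftrightarrow> has_bochner_integral M f I"
  unfolding has_strong_integral_def has_bochner_integral.simps
    strongly_measurable_iff_borel_measurable by auto


section \<open>Continuous operator frames\<close>

definition family_norm ::
    "'w measure \<Rightarrow> ('h \<Rightarrow> 'h \<Rightarrow> 'a::cstar_algebra) \<Rightarrow> ('w \<Rightarrow> 'h) \<Rightarrow> real" where
  "family_norm M ip X = sqrt (norm (strong_integral M (\<lambda>w. ip (X w) (X w))))"

text \<open>The existence of the integral, implicit in the frame inequality, is spelled out.\<close>

definition continuous_operator_frame_bounds ::
    "'w measure \<Rightarrow> ('h::banach \<Rightarrow> 'h \<Rightarrow> 'a::cstar_algebra) \<Rightarrow> ('w \<Rightarrow> 'h \<Rightarrow> 'h) \<Rightarrow>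
       real \<Rightarrow> real \<Rightarrow> bool" where
  "continuous_operator_frame_bounds M ip \<Lambda> A B \<longleftrightarrow>
     A > 0 \<and> B > 0 \<and>
     (\<forall>w\<in>space M. adjointable ip (\<Lambda> w)) \<and>
     (\<forall>x. strongly_measurable M (\<lambda>w. \<Lambda> w x)) \<and>
     (\<forall>x. strong_integrable M (\<lambda>w. ip (\<Lambda> w x) (\<Lambda> w x)) \<and>
          scaleR A (ip x x) \<sqsubseteq> strong_integral M (\<lambda>w. ip (\<Lambda> w x) (\<Lambda> w x)) \<and>
          strong_integral M (\<lambda>w. ip (\<Lambda> w x) (\<Lambda> w x)) \<sqsubseteq> scaleR B (ip x x))"

definition continuous_operator_frame ::
    "'w measure \<Rightarrow> ('h::banach \<Rightarrow> 'h \<Rightarrow> 'a::cstar_algebra) \<Rightarrow> ('w \<Rightarrow> 'h \<Rightarrow> 'h) \<Rightarrow> bool" where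
  "continuous_operator_frame M ip \<Lambda> \<longleftrightarrow>
     (\<exists>A B. continuous_operator_frame_bounds M ip \<Lambda> A B)"

end

theory Submission
  imports Defs
begin

text \<open>
  Write \<open>S\<^sub>w = \<Sum>\<^sub>k \<alpha>\<^sub>k T\<^sub>k\<^sub>,\<^sub>w\<close> and \<open>G x = \<integral> \<langle>S\<^sub>w x, S\<^sub>w x\<rangle>\<close>. If \<open>S\<close> is a frame with lower bound \<open>A'\<close>, monotonicity of
  the norm on the positive cone gives
  \<open>\<parallel>{T\<^sub>1 x}\<parallel>\<^sup>2 \<le> B\<^sub>1 \<parallel>\<langle>x,x\<rangle>\<parallel> \<le> (B\<^sub>1 / A') \<parallel>{S x}\<parallel>\<^sup>2\<close>, so that \<open>p = 1\<close> works.

  In the other direction the assumed inequality only bounds norms: it says \<open>\<parallel>\<langle>x,x\<rangle>\<parallel> \<le> c \<parallel>G x\<parallel>\<close> with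
  \<open>c = 1 / (\<lambda>\<^sup>2 A\<^sub>p)\<close>, whereas a frame needs \<open>\<langle>x,x\<rangle> \<le> c G x\<close> in the order of the algebra. The
  bridge is that the estimate holds for all module multiples \<open>a x\<close> at once. Adjointable operators are module
  linear, so both sides are conjugated: \<open>\<parallel>a p a\<^sup>*\<parallel> \<le> c \<parallel>a q a\<^sup>*\<parallel>\<close> for every \<open>a\<close>, where \<open>p = \<langle>x,x\<rangle>\<close>
  and \<open>q = G x\<close>. Taking \<open>a = (q + \<epsilon>)\<^sup>-\<^sup>1\<^sup>/\<^sup>2\<close> makes \<open>a q a \<le> 1\<close>, hence \<open>a p a \<le> c\<close>; conjugating back
  gives \<open>p \<le> c (q + \<epsilon>)\<close>, and \<open>\<epsilon> \<rightarrow> 0\<close> finishes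
  (\<open>cstar_le_if_conjugate_norms_le\<close>, \<open>frame_lower_bound_if_norm_lower_bound\<close>). The upper frame bound
  comes from integrating \<open>\<langle>\<Sum>u\<^sub>k, \<Sum>u\<^sub>k\<rangle> \<le> n \<Sum>\<langle>u\<^sub>k, u\<^sub>k\<rangle>\<close>, which also dominates the integrand and so
  provides the existence of \<open>G x\<close> (\<open>linear_combination_frames\<close>).

  Positivity is defined through the spectrum, but sums, limits and integrals are handled through the
  norm: a self-adjoint \<open>a\<close> is positive iff \<open>\<parallel>t - a\<parallel> \<le> t\<close> for some, equivalently every, \<open>t \<ge> \<parallel>a\<parallel>\<close>.
  This rests on two facts about self-adjoint elements, that their spectrum is real and that it
  bounds the norm (\<open>selfadjoint_norm_le_spectral_bound\<close>). Square roots and inverses of elements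
  close to \<open>1\<close> come from one binomial series.
\<close>

section \<open>Invertible elements, scalars and the involution\<close>

definition inverse_pair :: "'a::monoid_mult \<Rightarrow> 'a \<Rightarrow> bool" where
  "inverse_pair a b \<longleftrightarrow> b * a = 1 \<and> a * b = 1"

definition has_inverse :: "'a::monoid_mult \<Rightarrow> bool" where
  "has_inverse a \<longleftrightarrow> (\<exists>b. inverse_pair a b)"

lemma has_inverse_mult:
  assumes "has_inverse a" "has_inverse b"
  shows "has_inverse (a * b)"
proof -
  obtain a' b' where *: "a' * a = 1" "a * a' = 1" "b' * b = 1" "b * b' = 1"
    using assms unfolding has_inverse_def inverse_pair_def by blast
  have "(b' * a') * (a * b) = b' * (a' * a) * b" "(a * b) * (b' * a') = a * (b * b') * a'"
    by (simp_all only: mult.assoc)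
  then have "inverse_pair (a * b) (b' * a')"
    using * by (simp add: inverse_pair_def)
  then show ?thesis
    unfolding has_inverse_def by blast
qed

lemma scaleC_one: "scaleC 1 (a::'a::cstar_algebra) = a"
  using scaleC_of_real[of 1 a] by simp

lemma scaleC_zero_left: "scaleC 0 (a::'a::cstar_algebra) = 0"
  using scaleC_of_real[of 0 a] by simp

lemma scaleC_zero_right: "scaleC c (0::'a::cstar_algebra) = 0"
  by (metis scaleC_scaleC scaleC_zero_left mult_zero_right)

lemma scaleC_minus_left: "scaleC (- c) (a::'a::cstar_algebra) = - scaleC c a"
  using scaleC_add_left[of c "- c" a] by (simp add: scaleC_zero_left eq_neg_iff_add_eq_0 add.commute)

lemma scaleC_minus_right: "scaleC c (- a::'a::cstar_algebra) = - scaleC c a"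
  using scaleC_add_right[of c a "- a"] by (simp add: scaleC_zero_right eq_neg_iff_add_eq_0 add.commute)

lemma scaleC_diff_left: "scaleC (c - d) (a::'a::cstar_algebra) = scaleC c a - scaleC d a"
  using scaleC_add_left[of c "- d" a] by (simp add: scaleC_minus_left)

lemma scaleC_diff_right: "scaleC c (a - b::'a::cstar_algebra) = scaleC c a - scaleC c b"
  using scaleC_add_right[of c a "- b"] by (simp add: scaleC_minus_right)

lemma scaleC_scaleR: "scaleC c (r *\<^sub>R a) = scaleC (c * complex_of_real r) (a::'a::cstar_algebra)"
  by (simp add: scaleC_of_real[symmetric] scaleC_scaleC)

lemma scaleR_scaleC: "r *\<^sub>R scaleC c a = scaleC (complex_of_real r * c) (a::'a::cstar_algebra)"
  by (simp add: scaleC_of_real[symmetric] scaleC_scaleC)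

lemmas scaleC_mult_simps = mult_scaleC_left mult_scaleC_right scaleC_scaleC

lemma has_inverse_scaleC:
  assumes "c \<noteq> 0" "has_inverse (a::'a::cstar_algebra)"
  shows "has_inverse (scaleC c a)"
proof -
  obtain b where "inverse_pair a b" using assms(2) unfolding has_inverse_def by blast
  then have "inverse_pair (scaleC c a) (scaleC (1 / c) b)"
    using assms(1) by (simp add: inverse_pair_def scaleC_mult_simps scaleC_one)
  then show ?thesis unfolding has_inverse_def by blast
qed

lemma in_cstar_spectrum_iff: "z \<in> cstar_spectrum a \<longleftrightarrow> \<not> has_inverse (a - scaleC z 1)"
  by (simp add: cstar_spectrum_def has_inverse_def inverse_pair_def)

lemma norm_star: "norm (star a) = norm (a::'a::cstar_algebra)"
proof -
  have le: "norm b \<le> norm (star b)" for b :: 'a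
  proof (cases "b = 0")
    case False
    have "norm b * norm b \<le> norm (star b) * norm b"
      using norm_mult_ineq[of "star b" b] by (simp add: cstar_identity power2_eq_square)
    then show ?thesis using False by simp
  qed simp
  show ?thesis using le[of a] le[of "star a"] by (simp add: star_star)
qed

lemma star_one: "star 1 = (1::'a::cstar_algebra)"
  by (metis star_mult star_star mult_1_left mult_1_right)

lemma star_scaleR: "star (r *\<^sub>R a) = r *\<^sub>R star (a::'a::cstar_algebra)"
  using star_scaleC[of "complex_of_real r" a] by (simp add: scaleC_of_real)

lemma bounded_linear_star: "bounded_linear (star :: 'a::cstar_algebra \<Rightarrow> 'a)"
  by (rule bounded_linear_intro[where K = 1]) (simp_all add: star_add star_scaleR norm_star)

lemmas star_diff = linear_diff[OF bounded_linear.linear[OF bounded_linear_star]]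
lemmas star_zero = linear_0[OF bounded_linear.linear[OF bounded_linear_star]]
lemma star_power: "star (a ^ n) = star (a::'a::cstar_algebra) ^ n"
  by (induction n) (simp_all add: star_one star_mult power_commutes)

section \<open>The binomial series in a Banach algebra\<close>

text \<open>
  This is \<open>(1 - x)\<^sup>s\<close> for \<open>\<parallel>x\<parallel> < 1\<close>; the exponents \<open>-1\<close>, \<open>1/2\<close> and \<open>-1/2\<close> are the ones of interest.
\<close>

definition binomial_series :: "real \<Rightarrow> 'a \<Rightarrow> 'a::{banach,real_normed_algebra_1}" where
  "binomial_series s x = (\<Sum>n. (s gchoose n) *\<^sub>R (- x) ^ n)"

lemma summable_norm_binomial_series:
  fixes x :: "'a::{banach,real_normed_algebra_1}"
  assumes "norm x < 1"
  shows "summable (\<lambda>n. norm ((s gchoose n) *\<^sub>R (- x) ^ n))"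
proof (rule summable_comparison_test')
  have "ereal (norm (norm x)) < conv_radius (\<lambda>n. s gchoose n)"
    using assms by (simp add: conv_radius_gchoose)
  from abs_summable_in_conv_radius[OF this]
  show "summable (\<lambda>n. norm ((s gchoose n) * norm x ^ n))" .
  show "norm (norm ((s gchoose n) *\<^sub>R (- x) ^ n)) \<le> norm ((s gchoose n) * norm x ^ n)" if "0 \<le> n" for n
    using norm_power_ineq[of "- x" n] by (simp add: abs_mult mult_left_mono)
qed

text \<open>
  The Cauchy product of the two series is governed by Vandermonde's identity for generalised
  binomial coefficients.
\<close>

lemma binomial_series_mult:
  fixes x :: "'a::{banach,real_normed_algebra_1}"
  assumes "norm x < 1"
  shows "binomial_series s x * binomial_series t x = binomial_series (s + t) x"
proof -
  have "(\<Sum>i\<le>k. ((s gchoose i) *\<^sub>R (- x) ^ i) * ((t gchoose (k - i)) *\<^sub>R (- x) ^ (k - i)))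
      = ((s + t) gchoose k) *\<^sub>R (- x) ^ k" for k
  proof -
    have "(\<Sum>i\<le>k. ((s gchoose i) *\<^sub>R (- x) ^ i) * ((t gchoose (k - i)) *\<^sub>R (- x) ^ (k - i)))
      = (\<Sum>i\<le>k. ((s gchoose i) * (t gchoose (k - i))) *\<^sub>R (- x) ^ k)"
      by (intro sum.cong refl) (simp add: power_add[symmetric])
    also have "\<dots> = (\<Sum>i\<in>{0..k}. (s gchoose i) * (t gchoose (k - i))) *\<^sub>R (- x) ^ k"
      by (simp add: scaleR_sum_left atMost_atLeast0)
    also have "\<dots> = ((s + t) gchoose k) *\<^sub>R (- x) ^ k"
      by (subst gbinomial_Vandermonde) simp
    finally show ?thesis .
  qed
  then show ?thesis
    unfolding binomial_series_def
    using Cauchy_product[OF summable_norm_binomial_series[OF assms, of s] summable_norm_binomial_series[OF assms, of t]]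
    by simp
qed

lemma binomial_series_of_nat:
  "binomial_series (real m) x = (\<Sum>k\<le>m. of_nat (m choose k) * (- x) ^ k)"
proof -
  have "binomial_series (real m) x = (\<Sum>k\<in>{..m}. (real m gchoose k) *\<^sub>R (- x) ^ k)"
    unfolding binomial_series_def
    by (intro suminf_finite) (auto simp: binomial_gbinomial[symmetric])
  then show ?thesis
    by (simp add: binomial_gbinomial[symmetric] scaleR_conv_of_real)
qed

lemma binomial_series_0: "binomial_series 0 x = 1"
  using binomial_series_of_nat[of 0 x] by simp

lemma binomial_series_1: "binomial_series 1 x = 1 - x"
  using binomial_series_of_nat[of 1 x] by simp

lemma has_inverse_one_minus:
  fixes x :: "'a::{banach,real_normed_algebra_1}"
  assumes "norm x < 1"
  shows "has_inverse (1 - x)"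
  using binomial_series_mult[OF assms, of 1 "-1"] binomial_series_mult[OF assms, of "-1" 1]
  by (auto simp: has_inverse_def inverse_pair_def binomial_series_0 binomial_series_1)

lemma star_binomial_series:
  fixes x :: "'a::cstar_algebra"
  assumes "star x = x" "norm x < 1"
  shows "star (binomial_series s x) = binomial_series s x"
proof -
  have "star (- x) = - x"
    using star_diff[of 0 x] assms(1) by (simp add: star_zero)
  then have "star ((- x) ^ n) = (- x) ^ n" for n
    by (simp add: star_power)
  then show ?thesis
    unfolding binomial_series_def
    using bounded_linear.suminf[OF bounded_linear_star summable_norm_cancel[OF summable_norm_binomial_series[OF assms(2), of s]]]
    by (simp add: star_scaleR)
qed

section \<open>The spectrum of self-adjoint elements\<close>

lemma has_inverse_diff_scalar:
  fixes a :: "'a::cstar_algebra"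
  assumes "norm a < cmod z"
  shows "has_inverse (a - scaleC z 1)"
proof -
  have z: "z \<noteq> 0" using assms by auto
  have "norm (scaleC (1 / z) a) < 1"
    using assms z by (simp add: norm_scaleC norm_divide)
  then have "has_inverse (scaleC (- z) (1 - scaleC (1 / z) a))"
    using z by (intro has_inverse_scaleC has_inverse_one_minus) simp_all
  also have "scaleC (- z) (1 - scaleC (1 / z) a) = a - scaleC z 1"
    using z by (simp add: scaleC_diff_right scaleC_minus_left scaleC_scaleC scaleC_one)
  finally show ?thesis .
qed

text \<open>
  If \<open>z = u + i v\<close> were in the spectrum of \<open>a\<close>, then \<open>z + i s\<close> would be in the spectrum of \<open>a + i s\<close>
  for all real \<open>s\<close>, so \<open>(v + s)\<^sup>2 \<le> \<parallel>a + i s\<parallel>\<^sup>2 \<le> \<parallel>a\<parallel>\<^sup>2 + s\<^sup>2\<close>. For \<open>v \<noteq> 0\<close> this fails when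
  \<open>2 v s = \<parallel>a\<parallel>\<^sup>2\<close>.
\<close>

lemma selfadjoint_has_inverse_diff_nonreal:
  fixes a :: "'a::cstar_algebra"
  assumes a: "star a = a" and z: "Im z \<noteq> 0"
  shows "has_inverse (a - scaleC z 1)"
proof -
  \<comment> \<open>The value of \<open>s\<close> solves \<open>2 v s = \<parallel>a\<parallel>\<^sup>2\<close> for the imaginary part \<open>v\<close> of \<open>z\<close>.\<close>
  define s where "s = (norm a)\<^sup>2 / (2 * Im z)"
  define b where "b = a + scaleC (\<i> * s) 1"
  have "star b = a - scaleC (\<i> * s) 1"
    by (simp add: b_def star_add a star_scaleC star_one scaleC_minus_left)
  then have "star b * b = (a - scaleC (\<i> * s) 1) * (a + scaleC (\<i> * s) 1)"
    by (simp only: b_def)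
  also have "\<dots> = a * a - scaleC (\<i> * s * (\<i> * s)) 1"
    by (simp add: algebra_simps scaleC_mult_simps scaleC_diff_right)
  also have "\<i> * s * (\<i> * s) = - complex_of_real (s\<^sup>2)"
    by (simp add: power2_eq_square mult_ac)
  also have "a * a - scaleC (- complex_of_real (s\<^sup>2)) 1 = a * a + scaleC (s\<^sup>2) 1"
    by (simp only: scaleC_minus_left diff_minus_eq_add)
  finally have "star b * b = a * a + scaleC (s\<^sup>2) 1" .
  then have "(norm b)\<^sup>2 \<le> norm (a * a) + norm (scaleC (s\<^sup>2) (1::'a))"
    unfolding cstar_identity[symmetric] by (simp add: norm_triangle_ineq)
  also have "\<dots> \<le> (norm a)\<^sup>2 + s\<^sup>2"
    using norm_mult_ineq[of a a]
    by (simp add: norm_scaleC power2_eq_square norm_mult)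
  also have "\<dots> < (Im z + s)\<^sup>2"
  proof -
    have "2 * Im z * s = (norm a)\<^sup>2" using z by (simp add: s_def)
    then have "(Im z + s)\<^sup>2 = (Im z)\<^sup>2 + (norm a)\<^sup>2 + s\<^sup>2" by (simp add: power2_sum)
    then show ?thesis using z by simp
  qed
  also have "\<dots> \<le> (cmod (z + \<i> * s))\<^sup>2"
    by (simp add: cmod_power2)
  finally have "norm b < cmod (z + \<i> * s)"
    by (rule power_less_imp_less_base) simp
  then have "has_inverse (b - scaleC (z + \<i> * s) 1)"
    by (rule has_inverse_diff_scalar)
  then show ?thesis
    by (simp add: b_def scaleC_add_left)
qed

text \<open>
  The resolvent identity \<open>R w - R z = (w - z) R w c R z\<close> first bounds \<open>R w\<close> by \<open>2 \<parallel>R z\<parallel>\<close> for \<open>w\<close> close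
  to \<open>z\<close> and then gives continuity.
\<close>

lemma resolvent_continuous:
  fixes c :: "'a::cstar_algebra" and R :: "complex \<Rightarrow> 'a"
  assumes R: "\<And>z. z \<in> S \<Longrightarrow> inverse_pair (1 - scaleC z c) (R z)"
  shows "continuous_on S R"
proof (rule continuous_on_iff[THEN iffD2], intro ballI allI impI)
  fix z and e :: real assume z: "z \<in> S" and e: "0 < e"
  \<comment> \<open>The first bound in \<open>d\<close> ensures \<open>\<parallel>R w\<parallel> \<le> 2 \<parallel>R z\<parallel>\<close>, the second one the final estimate;
      the summands \<open>1\<close> only keep the denominators positive.\<close>
  define K where "K = norm c * norm (R z)"
  define d where "d = min (1 / (2 * K + 1)) (e / (4 * K * norm (R z) + 1))"
  have K: "0 \<le> K" by (simp add: K_def)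
  have "0 < d" using K e by (simp add: d_def add_nonneg_pos)
  moreover have "dist (R w) (R z) < e" if w: "w \<in> S" and wz: "dist w z < d" for w
  proof -
    have "R w - R z = R w * (1 - scaleC z c) * R z - R w * (1 - scaleC w c) * R z"
      using R[OF z] R[OF w] by (simp add: inverse_pair_def mult.assoc)
    also have "\<dots> = scaleC (w - z) (R w * c * R z)"
      by (simp add: algebra_simps scaleC_diff_left scaleC_mult_simps)
    finally have eq: "R w - R z = scaleC (w - z) (R w * c * R z)" .
    have "norm (R w * c * R z) \<le> norm (R w) * K"
    proof -
      have "norm (R w * c * R z) \<le> norm (R w * c) * norm (R z)" by (rule norm_mult_ineq)
      also have "\<dots> \<le> (norm (R w) * norm c) * norm (R z)"
        by (intro mult_right_mono norm_mult_ineq) simp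
      finally show ?thesis by (simp add: K_def mult.assoc)
    qed
    then have n1: "norm (R w - R z) \<le> cmod (w - z) * (norm (R w) * K)"
      unfolding eq norm_scaleC by (simp add: mult_left_mono)
    have "cmod (w - z) < 1 / (2 * K + 1)"
      using wz by (simp add: d_def dist_norm)
    then have "cmod (w - z) * (2 * K + 1) < 1"
      using K by (simp add: pos_less_divide_eq)
    then have "cmod (w - z) * K \<le> 1 / 2"
      by (simp add: algebra_simps) (smt (verit) norm_ge_zero)
    then have "norm (R w) * (cmod (w - z) * K) \<le> norm (R w) * (1 / 2)"
      by (rule mult_left_mono) simp
    then have "norm (R w - R z) \<le> norm (R w) / 2"
      using n1 by (simp add: mult_ac)
    then have "norm (R w) \<le> 2 * norm (R z)"
      using norm_triangle_sub[of "R w" "R z"] by simp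
    then have "cmod (w - z) * (norm (R w) * K) \<le> cmod (w - z) * (2 * norm (R z) * K)"
      using K by (intro mult_left_mono mult_right_mono) simp_all
    also have "\<dots> < e"
    proof -
      have "cmod (w - z) < e / (4 * K * norm (R z) + 1)"
        using wz by (simp add: d_def dist_norm)
      then have "cmod (w - z) * (4 * K * norm (R z) + 1) < e"
        using K by (simp add: pos_less_divide_eq add_nonneg_pos)
      moreover have "cmod (w - z) * (2 * norm (R z) * K) \<le> cmod (w - z) * (4 * K * norm (R z) + 1)"
        using K by (intro mult_left_mono) (simp_all add: mult_ac)
      ultimately show ?thesis by linarith
    qed
    finally show ?thesis
      using n1 by (simp add: dist_norm)
  qed
  ultimately show "\<exists>d>0. \<forall>w\<in>S. dist w z < d \<longrightarrow> dist (R w) (R z) < e"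
    by blast
qed

text \<open>
  The partial fraction \<open>1 / (1 - d\<^sup>2) = (1 / (1 - d) + 1 / (1 + d)) / 2\<close>.
\<close>

lemma inverse_pair_one_minus_square:
  fixes d :: "'a::real_algebra_1"
  assumes "inverse_pair (1 - d) G" "inverse_pair (1 + d) G'"
  shows "inverse_pair (1 - d * d) ((1 / 2) *\<^sub>R (G + G'))"
proof -
  have f: "1 - d * d = (1 - d) * (1 + d)" "1 - d * d = (1 + d) * (1 - d)"
    by (simp_all add: algebra_simps)
  have "G * (1 - d * d) = 1 + d" "(1 - d * d) * G = 1 + d"
    using assms(1) unfolding inverse_pair_def by (metis f mult.assoc mult_1_left mult_1_right)+
  moreover have "G' * (1 - d * d) = 1 - d" "(1 - d * d) * G' = 1 - d"
    using assms(2) unfolding inverse_pair_def by (metis f mult.assoc mult_1_left mult_1_right)+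
  moreover have "(1 / 2) *\<^sub>R (1 + d) + (1 / 2) *\<^sub>R (1 - d) = 1"
    by (simp add: scaleR_add_right[symmetric] scaleR_2[symmetric])
  ultimately show ?thesis
    by (simp add: inverse_pair_def distrib_left distrib_right scaleR_add_right)
qed

text \<open>
  This stands in for the analytic proof of the spectral radius formula. By the partial fraction above,
  the inverse of \<open>1 - z\<^sup>N c\<^sup>N\<close> for \<open>N = 2\<^sup>k\<close> is the mean of the inverses of \<open>1 - \<zeta> z c\<close> over the \<open>N\<close>-th roots of unity
  \<open>\<zeta>\<close>. Uniform continuity of the resolvent on the closed disc therefore makes the inverses of
  \<open>1 - r\<^sup>N c\<^sup>N\<close> and \<open>1 - c\<^sup>N\<close> close to each other, uniformly in \<open>N\<close>, for some fixed \<open>r < 1\<close>. As \<open>r\<^sup>N c\<^sup>N\<close> tends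
  to \<open>0\<close>, the inverse of \<open>1 - c\<^sup>N\<close> is eventually close to \<open>1\<close>, which forces \<open>c\<^sup>N\<close> to be small.
\<close>

lemma dyadic_power_norm_less_one:
  fixes c :: "'a::cstar_algebra"
  assumes c: "norm c \<le> 1" and inv: "\<And>z. cmod z \<le> 1 \<Longrightarrow> has_inverse (1 - scaleC z c)"
  shows "\<exists>k. norm (c ^ (2 ^ k)) < 1"
proof -
  define R where "R z = (SOME b. inverse_pair (1 - scaleC z c) b)" for z
  have R: "inverse_pair (1 - scaleC z c) (R z)" if "z \<in> cball 0 1" for z
    unfolding R_def by (rule someI_ex) (use inv[of z] that in \<open>simp add: has_inverse_def\<close>)
  have "uniformly_continuous_on (cball 0 1) R"
    by (intro compact_uniformly_continuous resolvent_continuous[of _ c] R) simp_all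
  \<comment> \<open>The tolerance \<open>1/8\<close> is chosen so that in the end \<open>\<parallel>c\<^sup>N\<parallel> \<le> 2 (1/7 + 1/8) < 1\<close>.\<close>
  from uniformly_continuous_onE[OF this, of "1/8"]
  obtain d where d: "0 < d"
    "\<And>z w. z \<in> cball 0 1 \<Longrightarrow> w \<in> cball 0 1 \<Longrightarrow> dist w z < d \<Longrightarrow> dist (R w) (R z) < 1 / 8"
    by auto
  define r where "r = 1 - min (d / 2) (1 / 2)"
  have r: "0 < r" "r < 1" "1 - r < d"
    using d(1) by (auto simp: r_def min_def)
  have main: "\<exists>G H. inverse_pair (1 - scaleC ((complex_of_real r * z) ^ (2 ^ k)) (c ^ (2 ^ k))) G
      \<and> inverse_pair (1 - scaleC (z ^ (2 ^ k)) (c ^ (2 ^ k))) H \<and> norm (G - H) \<le> 1 / 8"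
    if "cmod z = 1" for z :: complex and k
    using that
  proof (induction k arbitrary: z)
    case 0
    have rz: "complex_of_real r * z \<in> cball 0 1" "z \<in> cball 0 1"
      using 0 r by (simp_all add: norm_mult)
    have "dist (complex_of_real r * z) z = cmod (of_real (1 - r) * z)"
      by (simp add: dist_norm norm_minus_commute algebra_simps)
    also have "\<dots> < d" using 0 r by (simp only: norm_mult norm_of_real) simp
    finally have "norm (R (complex_of_real r * z) - R z) \<le> 1 / 8"
      using d(2)[OF rz(2,1)] by (simp add: dist_norm)
    then show ?case using R[OF rz(1)] R[OF rz(2)] by auto
  next
    case (Suc k)
    define N :: nat where "N = 2 ^ k"
    \<comment> \<open>Multiplying \<open>z\<close> by this root of \<open>-1\<close> flips the sign of \<open>z\<^sup>N\<close>,
        so the induction hypothesis covers both factors of \<open>1 - z\<^sup>2\<^sup>N c\<^sup>2\<^sup>N\<close>.\<close>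
    define w where "w = cis (pi / N)"
    have N: "0 < N" by (simp add: N_def)
    have "w ^ N = cis (real N * (pi / N))" by (simp only: w_def Complex.DeMoivre)
    then have "w ^ N = -1" using N by simp
    then have wN: "(x * (w * z)) ^ N = - ((x * z) ^ N)" for x
      by (simp add: power_mult_distrib)
    have wN1: "(w * z) ^ N = - (z ^ N)" using wN[of 1] by simp
    have "cmod (w * z) = 1" using Suc.prems by (simp add: w_def norm_mult)
    from Suc.IH[OF this] obtain G' H' where
      "inverse_pair (1 - scaleC ((complex_of_real r * (w * z)) ^ N) (c ^ N)) G'"
      "inverse_pair (1 - scaleC ((w * z) ^ N) (c ^ N)) H'" and n': "norm (G' - H') \<le> 1 / 8"
      unfolding N_def by blast
    then have 1: "inverse_pair (1 + scaleC ((complex_of_real r * z) ^ N) (c ^ N)) G'"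
      "inverse_pair (1 + scaleC (z ^ N) (c ^ N)) H'"
      by (simp_all only: wN wN1 scaleC_minus_left diff_minus_eq_add)
    from Suc.IH[OF Suc.prems] obtain G H where
      2: "inverse_pair (1 - scaleC ((complex_of_real r * z) ^ N) (c ^ N)) G"
      "inverse_pair (1 - scaleC (z ^ N) (c ^ N)) H" and n: "norm (G - H) \<le> 1 / 8"
      unfolding N_def by blast
    have sq: "scaleC (x ^ N) (c ^ N) * scaleC (x ^ N) (c ^ N) = scaleC (x ^ (2 ^ Suc k)) (c ^ (2 ^ Suc k))" for x
      by (simp add: scaleC_mult_simps power_add[symmetric] N_def mult_2)
    have "(1 / 2) *\<^sub>R (G + G') - (1 / 2) *\<^sub>R (H + H') = (1 / 2) *\<^sub>R ((G - H) + (G' - H'))"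
      by (simp add: algebra_simps)
    then have "norm ((1 / 2) *\<^sub>R (G + G') - (1 / 2) *\<^sub>R (H + H')) = norm ((G - H) + (G' - H')) / 2"
      by simp
    also have "\<dots> \<le> 1 / 8"
      using norm_triangle_ineq[of "G - H" "G' - H'"] n n' by simp
    finally show ?case
      using inverse_pair_one_minus_square[OF 2(1) 1(1)] inverse_pair_one_minus_square[OF 2(2) 1(2)]
      unfolding sq by blast
  qed
  obtain m where m: "r ^ m < 1 / 8"
    using real_arch_pow_inv[of "1 / 8" r] r by auto
  define N :: nat where "N = 2 ^ m"
  have "m \<le> N" unfolding N_def by (simp add: less_imp_le)
  then have rN: "r ^ N < 1 / 8"
    using m r power_decreasing[of m N r] by linarith
  have cN: "norm (c ^ N) \<le> 1"
    using norm_power_ineq[of c N] power_le_one[OF norm_ge_zero c, of N] by linarith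
  obtain G H where G: "inverse_pair (1 - scaleC (complex_of_real r ^ N) (c ^ N)) G"
    and H: "inverse_pair (1 - c ^ N) H" and GH: "norm (G - H) \<le> 1 / 8"
    using main[of 1 m] by (auto simp: N_def scaleC_one)
  define x where "x = scaleC (complex_of_real r ^ N) (c ^ N)"
  have x: "norm x \<le> 1 / 8"
  proof -
    have "norm x = r ^ N * norm (c ^ N)"
      using r by (simp add: x_def norm_scaleC norm_power)
    also have "\<dots> \<le> (1 / 8) * 1"
      using rN cN r by (intro mult_mono) simp_all
    finally show ?thesis by simp
  qed
  have G1: "G - 1 = G * x"
    using G unfolding x_def[symmetric] inverse_pair_def by (simp add: algebra_simps)
  have nGx: "norm (G * x) \<le> norm G * (1 / 8)"
    by (rule order_trans[OF norm_mult_ineq]) (intro mult_left_mono x, simp)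
  then have "norm G \<le> 1 + norm G * (1 / 8)"
    using norm_triangle_sub[of G 1] unfolding G1 by simp
  then have "norm (G - 1) \<le> 1 / 7"
    using nGx unfolding G1 by simp
  then have "norm (H - 1) \<le> 1 / 7 + 1 / 8"
    using GH norm_triangle_ineq[of "G - 1" "H - G"] by (simp add: norm_minus_commute)
  have "c ^ N = (H - 1) * (1 - c ^ N)"
    using H unfolding inverse_pair_def by (simp add: algebra_simps)
  then have "norm (c ^ N) \<le> norm (H - 1) * norm (1 - c ^ N)"
    by (metis norm_mult_ineq)
  also have "\<dots> \<le> (1 / 7 + 1 / 8) * 2"
    using \<open>norm (H - 1) \<le> 1 / 7 + 1 / 8\<close> cN norm_triangle_ineq4[of 1 "c ^ N"] by (intro mult_mono) simp_all
  also have "\<dots> < 1" by simp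
  finally show ?thesis unfolding N_def by blast
qed

lemma selfadjoint_norm_dyadic_power:
  assumes "star a = (a::'a::cstar_algebra)"
  shows "norm (a ^ (2 ^ k)) = norm a ^ (2 ^ k)"
proof (induction k)
  case (Suc k)
  have "a ^ (2 ^ Suc k) = star (a ^ (2 ^ k)) * a ^ (2 ^ k)"
    by (simp add: star_power assms power_add[symmetric] mult_2)
  then have "norm (a ^ (2 ^ Suc k)) = (norm (a ^ (2 ^ k)))\<^sup>2"
    by (simp only: cstar_identity)
  also have "\<dots> = norm a ^ (2 ^ Suc k)"
    unfolding Suc.IH by (simp add: power_mult[symmetric] mult.commute)
  finally show ?case .
qed simp

text \<open>
  If \<open>\<parallel>a\<parallel>\<close> exceeded the spectral bound, the normalised element \<open>c = a / \<parallel>a\<parallel>\<close> would satisfy the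
  hypotheses of \<open>dyadic_power_norm_less_one\<close>, while the C*-identity keeps all its dyadic powers at norm \<open>1\<close>.
\<close>

lemma selfadjoint_norm_le_spectral_bound:
  fixes a :: "'a::cstar_algebra"
  assumes a: "star a = a" and t: "0 \<le> t" "\<And>z. z \<in> cstar_spectrum a \<Longrightarrow> cmod z \<le> t"
  shows "norm a \<le> t"
proof (rule ccontr)
  assume "\<not> norm a \<le> t"
  then have gt: "t < norm a" and pos: "0 < norm a" using t by auto
  define c where "c = (1 / norm a) *\<^sub>R a"
  have c: "norm c = 1" "star c = c"
    using pos a by (simp_all add: c_def star_scaleR)
  have "has_inverse (1 - scaleC z c)" if z: "cmod z \<le> 1" for z
  proof (cases "z = 0")
    case True
    then show ?thesis using has_inverse_one_minus[of "0::'a"] by (simp add: scaleC_zero_left)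
  next
    case False
    have "norm a \<le> cmod (norm a / z)"
      using z False pos by (simp add: norm_divide field_simps)
    then have "norm a / z \<notin> cstar_spectrum a"
      using t(2)[of "norm a / z"] gt by linarith
    then have "has_inverse (scaleC (- (z / norm a)) (a - scaleC (norm a / z) 1))"
      using False pos by (intro has_inverse_scaleC) (simp_all add: in_cstar_spectrum_iff)
    also have "scaleC (- (z / norm a)) (a - scaleC (norm a / z) 1) = 1 - scaleC z c"
      using False pos
      by (simp add: c_def scaleC_diff_right scaleC_minus_left scaleC_scaleC scaleC_one scaleC_scaleR)
    finally show ?thesis .
  qed
  from dyadic_power_norm_less_one[OF _ this] c(1)
  obtain k where "norm (c ^ (2 ^ k)) < 1" by auto
  then show False
    by (simp add: selfadjoint_norm_dyadic_power[OF c(2)] c(1))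
qed

section \<open>The positive cone\<close>

lemma spectrum_norm_bound: "z \<in> cstar_spectrum (a::'a::cstar_algebra) \<Longrightarrow> cmod z \<le> norm a"
  using has_inverse_diff_scalar[of a z] by (force simp: in_cstar_spectrum_iff)

lemma spectrum_scalar_diff:
  "z \<in> cstar_spectrum (t *\<^sub>R 1 - a) \<longleftrightarrow> complex_of_real t - z \<in> cstar_spectrum (a::'a::cstar_algebra)"
proof -
  have eq: "scaleC (-1) (t *\<^sub>R 1 - a - scaleC z 1) = a - scaleC (complex_of_real t - z) 1"
    by (simp add: scaleC_diff_right scaleC_minus_left scaleC_one scaleC_diff_left scaleC_of_real)
  have eq': "scaleC (-1) (a - scaleC (complex_of_real t - z) 1) = t *\<^sub>R 1 - a - scaleC z 1"
    by (simp add: scaleC_diff_right scaleC_minus_left scaleC_one scaleC_diff_left scaleC_of_real)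
  show ?thesis
    unfolding in_cstar_spectrum_iff
    using has_inverse_scaleC[of "-1" "t *\<^sub>R 1 - a - scaleC z 1"]
      has_inverse_scaleC[of "-1" "a - scaleC (complex_of_real t - z) 1"]
    unfolding eq eq' by auto
qed

lemma selfadjoint_scalar_diff:
  "star a = a \<Longrightarrow> star (t *\<^sub>R 1 - a) = t *\<^sub>R 1 - (a::'a::cstar_algebra)"
  by (simp add: star_diff star_scaleR star_one)

text \<open>
  The spectrum of a self-adjoint element is real, so only negative real numbers have to be excluded.
\<close>

lemma cstar_positiveI_real:
  fixes a :: "'a::cstar_algebra"
  assumes "star a = a" "\<And>t. 0 < t \<Longrightarrow> has_inverse (a + t *\<^sub>R 1)"
  shows "cstar_positive a"
proof -
  have "z \<in> \<real>\<^sub>\<ge>\<^sub>0" if z: "z \<in> cstar_spectrum a" for z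
  proof -
    have Im: "Im z = 0"
      using selfadjoint_has_inverse_diff_nonreal[OF assms(1), of z] z
      by (auto simp: in_cstar_spectrum_iff)
    have "0 \<le> Re z"
    proof (rule ccontr)
      assume "\<not> 0 \<le> Re z"
      then have "has_inverse (a + (- Re z) *\<^sub>R 1)" by (intro assms(2)) simp
      moreover have "z = complex_of_real (Re z)"
        using Im by (simp add: complex_eq_iff)
      then have "scaleC z 1 = Re z *\<^sub>R (1::'a)"
        using scaleC_of_real[of "Re z" 1] by simp
      ultimately show False using z by (simp add: in_cstar_spectrum_iff)
    qed
    with Im show ?thesis by (simp add: complex_nonneg_Reals_iff)
  qed
  then show ?thesis using assms(1) by (auto simp: cstar_positive_def)
qed

lemma cstar_positive_has_inverse:
  fixes a :: "'a::cstar_algebra"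
  assumes "cstar_positive a" "0 < t"
  shows "has_inverse (a + t *\<^sub>R 1)"
proof -
  have "complex_of_real (- t) \<notin> cstar_spectrum a"
    using assms by (auto simp: cstar_positive_def complex_nonneg_Reals_iff subset_iff)
  then have "has_inverse (a - scaleC (complex_of_real (- t)) 1)"
    by (simp only: in_cstar_spectrum_iff not_not)
  then show ?thesis by (simp only: scaleC_of_real) simp
qed

text \<open>
  The spectrum of \<open>a\<close> lies in \<open>[0, \<parallel>a\<parallel>]\<close>, hence that of the self-adjoint element \<open>t - a\<close> lies in \<open>[0, t]\<close>,
  and this bounds its norm.
\<close>

lemma cstar_positive_imp_norm:
  fixes a :: "'a::cstar_algebra"
  assumes a: "cstar_positive a" and t: "norm a \<le> t"
  shows "norm (t *\<^sub>R 1 - a) \<le> t"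
proof (rule selfadjoint_norm_le_spectral_bound)
  show "star (t *\<^sub>R 1 - a) = t *\<^sub>R 1 - a"
    using a by (simp add: selfadjoint_scalar_diff cstar_positive_def)
  show "0 \<le> t" using t norm_ge_zero[of a] by linarith
  fix z assume "z \<in> cstar_spectrum (t *\<^sub>R 1 - a)"
  then have *: "complex_of_real t - z \<in> cstar_spectrum a"
    by (simp add: spectrum_scalar_diff)
  then have nn: "complex_of_real t - z \<in> \<real>\<^sub>\<ge>\<^sub>0"
    using a by (auto simp: cstar_positive_def)
  then obtain s where s: "complex_of_real t - z = complex_of_real s" "0 \<le> s"
    by (auto simp: nonneg_Reals_def)
  have "s \<le> t" using spectrum_norm_bound[OF *] s t by simp
  moreover have "z = complex_of_real (t - s)" using s by (simp add: algebra_simps)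
  ultimately show "cmod z \<le> t" using s by (simp only: norm_of_real)
qed

text \<open>
  For \<open>s > 0\<close> one has \<open>a + s = (t + s) - (t - a)\<close> with \<open>\<parallel>t - a\<parallel> \<le> t < t + s\<close>, which is invertible by the
  Neumann series.
\<close>

lemma cstar_positive_if_norm:
  fixes a :: "'a::cstar_algebra"
  assumes a: "star a = a" and t: "norm (t *\<^sub>R 1 - a) \<le> t"
  shows "cstar_positive a"
proof (rule cstar_positiveI_real[OF a])
  fix s :: real assume "0 < s"
  have "norm (t *\<^sub>R 1 - a) < cmod (complex_of_real (s + t))"
    using t \<open>0 < s\<close> norm_ge_zero[of "t *\<^sub>R 1 - a"] by (simp only: norm_of_real)
  from has_inverse_scaleC[OF _ has_inverse_diff_scalar[OF this], of "-1"]
  show "has_inverse (a + s *\<^sub>R 1)"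
    by (simp only: scaleC_of_real)
      (simp add: scaleC_minus_left scaleC_one algebra_simps)
qed

lemma cstar_positive_add:
  assumes "cstar_positive a" "cstar_positive b"
  shows "cstar_positive (a + b)"
proof (rule cstar_positive_if_norm[where t = "norm a + norm b"])
  show "star (a + b) = a + b" using assms by (simp add: cstar_positive_def star_add)
  have "norm ((norm a + norm b) *\<^sub>R 1 - (a + b)) = norm ((norm a *\<^sub>R 1 - a) + (norm b *\<^sub>R 1 - b))"
    by (simp add: algebra_simps)
  also have "\<dots> \<le> norm a + norm b"
    using assms by (intro norm_triangle_mono cstar_positive_imp_norm) auto
  finally show "norm ((norm a + norm b) *\<^sub>R 1 - (a + b)) \<le> norm a + norm b" .
qed

lemma cstar_positive_scalar: "0 \<le> t \<Longrightarrow> cstar_positive (t *\<^sub>R 1 :: 'a::cstar_algebra)"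
  by (rule cstar_positive_if_norm[where t = t]) (simp_all add: star_scaleR star_one)

lemma cstar_positive_zero: "cstar_positive (0::'a::cstar_algebra)"
  using cstar_positive_scalar[of 0] by simp

lemma cstar_positive_sum:
  "(\<And>i. i \<in> I \<Longrightarrow> cstar_positive (f i)) \<Longrightarrow> cstar_positive (\<Sum>i\<in>I. f i)"
  by (induction I rule: infinite_finite_induct) (simp_all add: cstar_positive_zero cstar_positive_add)

lemma cstar_positive_scaleR:
  assumes "cstar_positive a" "0 \<le> r"
  shows "cstar_positive (r *\<^sub>R a)"
proof (rule cstar_positive_if_norm[where t = "r * norm a"])
  show "star (r *\<^sub>R a) = r *\<^sub>R a" using assms by (simp add: cstar_positive_def star_scaleR)
  have "norm ((r * norm a) *\<^sub>R 1 - r *\<^sub>R a) = r * norm (norm a *\<^sub>R 1 - a)"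
    using assms(2) by (simp add: scaleR_scaleR[symmetric] scaleR_diff_right[symmetric] del: scaleR_scaleR)
  also have "\<dots> \<le> r * norm a"
    using assms by (intro mult_left_mono cstar_positive_imp_norm) auto
  finally show "norm ((r * norm a) *\<^sub>R 1 - r *\<^sub>R a) \<le> r * norm a" .
qed

lemma cstar_positive_iff_norm:
  "cstar_positive a \<longleftrightarrow> star a = a \<and> norm (norm a *\<^sub>R 1 - a) \<le> norm a"
  using cstar_positive_imp_norm[of a "norm a"] cstar_positive_if_norm[of a "norm a"]
  by (auto simp: cstar_positive_def)

lemma closed_cstar_positive: "closed {a::'a::cstar_algebra. cstar_positive a}"
proof -
  have "continuous_on UNIV (star :: 'a \<Rightarrow> 'a)"
    by (rule linear_continuous_on[OF bounded_linear_star])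
  then show ?thesis
    unfolding cstar_positive_iff_norm
    by (intro closed_Collect_conj closed_Collect_eq closed_Collect_le continuous_intros) auto
qed

lemma cstar_positive_norm_diff: "star a = a \<Longrightarrow> norm a \<le> t \<Longrightarrow> cstar_positive (t *\<^sub>R 1 - (a::'a::cstar_algebra))"
  by (rule cstar_positive_if_norm[where t = t]) (simp_all add: selfadjoint_scalar_diff)

lemma norm_le_if_between:
  fixes a :: "'a::cstar_algebra"
  assumes a: "cstar_positive a" and ta: "cstar_positive (t *\<^sub>R 1 - a)" and t: "0 \<le> t"
  shows "norm a \<le> t"
proof (rule selfadjoint_norm_le_spectral_bound[OF _ t])
  show "star a = a" using a by (simp add: cstar_positive_def)
  fix z assume z: "z \<in> cstar_spectrum a"
  then have "complex_of_real t - z \<in> cstar_spectrum (t *\<^sub>R 1 - a)"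
    by (simp add: spectrum_scalar_diff)
  then have "complex_of_real t - z \<in> \<real>\<^sub>\<ge>\<^sub>0" "z \<in> \<real>\<^sub>\<ge>\<^sub>0"
    using z a ta by (auto simp: cstar_positive_def)
  then show "cmod z \<le> t"
    by (auto simp: nonneg_Reals_def) (metis Re_complex_of_real add_increasing2 diff_eq_eq minus_complex.sel(1) norm_of_real abs_of_nonneg order_refl add.commute)
qed

lemma cstar_le_trans: "a \<sqsubseteq> b \<Longrightarrow> b \<sqsubseteq> c \<Longrightarrow> a \<sqsubseteq> c"
  unfolding cstar_le_def using cstar_positive_add[of "b - a" "c - b"] by simp

text \<open>
  From \<open>0 \<le> a \<le> b \<le> \<parallel>b\<parallel>\<close>, where the last inequality holds for every self-adjoint \<open>b\<close>.
\<close>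

lemma cstar_norm_mono:
  assumes "cstar_positive a" "a \<sqsubseteq> b"
  shows "norm a \<le> norm b"
proof (rule norm_le_if_between[OF assms(1)])
  have "cstar_positive b"
    using cstar_positive_add[OF assms(1), of "b - a"] assms(2) by (simp add: cstar_le_def)
  then have "b \<sqsubseteq> norm b *\<^sub>R 1"
    unfolding cstar_le_def by (intro cstar_positive_norm_diff) (simp_all add: cstar_positive_def)
  with assms(2) show "cstar_positive (norm b *\<^sub>R 1 - a)"
    using cstar_le_trans unfolding cstar_le_def by blast
qed simp

section \<open>Comparing positive elements by conjugation\<close>

text \<open>
  With \<open>z = i \<surd>t\<close> the element \<open>s\<^sup>2 + t\<close> factors as \<open>(s - z) (s + z)\<close>, and both factors are invertible
  because \<open>s\<close> has real spectrum.
\<close>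

lemma cstar_positive_square:
  fixes s :: "'a::cstar_algebra"
  assumes s: "star s = s"
  shows "cstar_positive (s * s)"
proof (rule cstar_positiveI_real)
  show "star (s * s) = s * s" by (simp add: star_mult s)
  fix t :: real assume t: "0 < t"
  define z where "z = \<i> * complex_of_real (sqrt t)"
  have z: "z * z = - complex_of_real t"
  proof -
    have "z * z = - (complex_of_real (sqrt t))\<^sup>2" by (simp add: z_def power2_eq_square mult_ac)
    then show ?thesis using t by (simp add: of_real_power[symmetric] del: of_real_power)
  qed
  have "has_inverse ((s - scaleC z 1) * (s - scaleC (- z) 1))"
    using t by (intro has_inverse_mult selfadjoint_has_inverse_diff_nonreal[OF s]) (simp_all add: z_def)
  also have "(s - scaleC z 1) * (s - scaleC (- z) 1) = s * s - scaleC (z * z) 1"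
    by (simp add: scaleC_minus_left algebra_simps scaleC_mult_simps scaleC_diff_right)
  also have "\<dots> = s * s + t *\<^sub>R 1"
    by (simp add: z scaleC_minus_left scaleC_of_real)
  finally show "has_inverse (s * s + t *\<^sub>R 1)" .
qed

text \<open>
  The spectrum of \<open>s\<^sup>2\<close> is nonnegative and misses a neighbourhood of \<open>0\<close>, since
  \<open>s\<^sup>2 - u = s\<^sup>2 (1 - u r\<^sup>2)\<close> is invertible as soon as \<open>u \<parallel>r\<^sup>2\<parallel> < 1\<close>.
\<close>

lemma cstar_positive_inverse_square_lower:
  fixes s :: "'a::cstar_algebra"
  assumes s: "star s = s" and rs: "inverse_pair r s"
  shows "\<exists>d>0. cstar_positive (s * s - d *\<^sub>R 1)"
proof (intro exI conjI)
  define d where "d = 1 / (norm (r * r) + 1)"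
  show "0 < d" by (simp add: d_def add_nonneg_pos)
  show "cstar_positive (s * s - d *\<^sub>R 1)"
  proof (rule cstar_positiveI_real)
    show "star (s * s - d *\<^sub>R 1) = s * s - d *\<^sub>R 1"
      by (simp add: star_diff star_mult s star_scaleR star_one)
    fix t :: real assume t: "0 < t"
    show "has_inverse (s * s - d *\<^sub>R 1 + t *\<^sub>R 1)"
    proof (cases "d < t")
      case True
      from cstar_positive_has_inverse[OF cstar_positive_square[OF s], of "t - d"] True
      show ?thesis by (simp add: algebra_simps)
    next
      case False
      have "has_inverse s" using rs by (auto simp: has_inverse_def inverse_pair_def)
      moreover have "has_inverse (1 - (d - t) *\<^sub>R (r * r))"
      proof (rule has_inverse_one_minus)
        have "(d - t) * norm (r * r) \<le> d * norm (r * r)"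
          using t by (intro mult_right_mono) auto
        also have "\<dots> < 1" by (simp add: d_def pos_divide_less_eq add_nonneg_pos)
        finally show "norm ((d - t) *\<^sub>R (r * r)) < 1" using False by simp
      qed
      ultimately have "has_inverse (s * s * (1 - (d - t) *\<^sub>R (r * r)))"
        by (intro has_inverse_mult)
      moreover have "s * s * (r * r) = 1"
      proof -
        have "s * s * (r * r) = s * (s * r) * r" by (simp only: mult.assoc)
        then show ?thesis using rs by (simp add: inverse_pair_def)
      qed
      ultimately show ?thesis by (simp add: algebra_simps)
    qed
  qed
qed

text \<open>
  Only \<open>r y r + t\<close> for \<open>t > 0\<close> has to be inverted. Now \<open>r y r + t = r (y + t s\<^sup>2) r\<close>, and \<open>y + t s\<^sup>2\<close> is a positive element plus a positive
  scalar because \<open>s\<^sup>2\<close> is bounded below.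
\<close>

lemma cstar_positive_conjugate:
  fixes y :: "'a::cstar_algebra"
  assumes y: "cstar_positive y" and r: "star r = r" and s: "star s = s" and rs: "inverse_pair r s"
  shows "cstar_positive (r * y * r)"
proof (rule cstar_positiveI_real)
  show "star (r * y * r) = r * y * r"
    using y r by (simp add: star_mult cstar_positive_def mult.assoc)
  fix t :: real assume t: "0 < t"
  obtain d where d: "0 < d" "cstar_positive (s * s - d *\<^sub>R 1)"
    using cstar_positive_inverse_square_lower[OF s rs] by blast
  have "cstar_positive (y + t *\<^sub>R (s * s - d *\<^sub>R 1))"
    using y d t by (intro cstar_positive_add cstar_positive_scaleR) auto
  from cstar_positive_has_inverse[OF this, of "t * d"]
  have "has_inverse (y + t *\<^sub>R (s * s))"
    using t d by (simp add: algebra_simps)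
  moreover have "has_inverse r" using rs by (auto simp: has_inverse_def)
  ultimately have "has_inverse (r * (y + t *\<^sub>R (s * s)) * r)"
    by (intro has_inverse_mult)
  also have "r * (y + t *\<^sub>R (s * s)) * r = r * y * r + t *\<^sub>R ((r * s) * (s * r))"
    by (simp add: algebra_simps)
  finally show "has_inverse (r * y * r + t *\<^sub>R 1)"
    using rs by (simp add: inverse_pair_def)
qed

text \<open>
  After scaling by \<open>K = \<parallel>q\<parallel> + e\<close>, the element \<open>q + e\<close> has the form \<open>1 - x\<close> with \<open>\<parallel>x\<parallel> \<le> \<parallel>q\<parallel> / K < 1\<close>, by the norm
  characterisation of positivity. So the binomial series for the exponents \<open>1/2\<close> and \<open>-1/2\<close>
  converge at \<open>x\<close>.
\<close>

lemma cstar_positive_shift_sqrt: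
  fixes q :: "'a::cstar_algebra"
  assumes q: "cstar_positive q" and e: "0 < e"
  obtains r a where "star r = r" "star a = a" "inverse_pair r a" "r * r = q + e *\<^sub>R 1"
proof -
  define K where "K = norm q + e"
  have K: "0 < K" using e by (simp add: K_def add_nonneg_pos)
  define x where "x = (1 / K) *\<^sub>R (norm q *\<^sub>R 1 - q)"
  have "norm (norm q *\<^sub>R 1 - q) \<le> norm q"
    by (rule cstar_positive_imp_norm[OF q order_refl])
  then have "norm x < 1"
    using K e by (simp add: x_def pos_divide_less_eq K_def)
  note x = this
  have sx: "star x = x"
    using q by (simp add: x_def star_scaleR selfadjoint_scalar_diff cstar_positive_def)
  define r where "r = sqrt K *\<^sub>R binomial_series (1/2) x"
  define a where "a = (1 / sqrt K) *\<^sub>R binomial_series (-1/2) x"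
  show thesis
  proof
    show "star r = r" "star a = a"
      by (simp_all add: r_def a_def star_scaleR star_binomial_series[OF sx x])
    show "inverse_pair r a"
      using K by (simp add: inverse_pair_def r_def a_def binomial_series_mult[OF x] binomial_series_0)
    have "r * r = K *\<^sub>R (1 - x)"
      using K by (simp add: r_def binomial_series_mult[OF x] binomial_series_1)
    also have "\<dots> = K *\<^sub>R 1 - (norm q *\<^sub>R 1 - q)"
      using K by (simp add: x_def scaleR_diff_right)
    finally show "r * r = q + e *\<^sub>R 1" by (simp add: K_def algebra_simps)
  qed
qed

text \<open>
  A norm inequality that is stable under conjugation is already an order inequality. The test
  element is \<open>a = (q + e)\<^sup>-\<^sup>1\<^sup>/\<^sup>2\<close>, for which \<open>a q a = 1 - e a\<^sup>2 \<le> 1\<close>.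
\<close>

lemma cstar_le_if_conjugate_norms_le:
  fixes p q :: "'a::cstar_algebra"
  assumes p: "star p = p" and q: "cstar_positive q" and c: "0 \<le> c"
    and le: "\<And>a. norm (a * p * star a) \<le> c * norm (a * q * star a)"
  shows "p \<sqsubseteq> c *\<^sub>R q"
proof -
  have step: "cstar_positive (c *\<^sub>R (q + e *\<^sub>R 1) - p)" if e: "0 < e" for e
  proof -
    obtain r a where r: "star r = r" and a: "star a = a" and ra: "inverse_pair r a"
      and rr: "r * r = q + e *\<^sub>R 1"
      using cstar_positive_shift_sqrt[OF q e] .
    have ar: "inverse_pair a r" using ra by (simp add: inverse_pair_def)
    have cancel: "r * (a * z * a) * r = z" "a * (r * z * r) * a = z" for z
      using ra unfolding inverse_pair_def by (metis mult.assoc mult_1_left mult_1_right)+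
    have "a * (q + e *\<^sub>R 1) * a = 1"
      using cancel(2)[of 1] rr by simp
    then have "1 - a * q * a = e *\<^sub>R (a * a)"
      by (simp add: algebra_simps)
    then have "cstar_positive (1 *\<^sub>R 1 - a * q * a)"
      using e by (simp add: cstar_positive_scaleR cstar_positive_square[OF a])
    then have "norm (a * q * a) \<le> 1"
      by (intro norm_le_if_between cstar_positive_conjugate[OF q a r ar]) simp_all
    then have "norm (a * p * a) \<le> c"
      using le[of a] c mult_left_mono[of "norm (a * q * a)" 1 c] by (simp add: a)
    then have "cstar_positive (c *\<^sub>R 1 - a * p * a)"
      by (intro cstar_positive_norm_diff) (simp add: star_mult p a mult.assoc)
    from cstar_positive_conjugate[OF this r a ra]
    show ?thesis
      using cancel(1)[of p] rr by (simp add: algebra_simps)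
  qed
  have "cstar_positive (c *\<^sub>R (q + 0 *\<^sub>R 1) - p)"
  proof (rule Lim_in_closed_set[OF closed_cstar_positive, simplified mem_Collect_eq])
    show "((\<lambda>e. c *\<^sub>R (q + e *\<^sub>R 1) - p) \<longlongrightarrow> c *\<^sub>R (q + 0 *\<^sub>R 1) - p) (at_right 0)"
      by (intro tendsto_intros)
    show "\<forall>\<^sub>F e in at_right 0. cstar_positive (c *\<^sub>R (q + e *\<^sub>R 1) - p)"
      using step by (simp add: eventually_at_right_less eventually_at_filter)
  qed simp
  then show ?thesis by (simp add: cstar_le_def)
qed

section \<open>Strong measurability and the strong integral\<close>

lemma strongly_measurable_compose:
  assumes "strongly_measurable M f" "continuous_on UNIV h"
  shows "strongly_measurable M (\<lambda>w. h (f w))"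
proof -
  obtain s where s: "\<And>i. simple_function M (s i)" "\<And>w. w \<in> space M \<Longrightarrow> (\<lambda>i. s i w) \<longlonglongrightarrow> f w"
    using assms(1) unfolding strongly_measurable_def by blast
  have "(\<lambda>i. h (s i w)) \<longlonglongrightarrow> h (f w)" if "w \<in> space M" for w
    by (rule continuous_on_tendsto_compose[OF assms(2) s(2)[OF that]]) auto
  then show ?thesis
    unfolding strongly_measurable_def
    by (intro exI[of _ "\<lambda>i w. h (s i w)"]) (auto intro: simple_function_compose1 s(1))
qed

lemma strongly_measurable_Pair:
  assumes "strongly_measurable M f" "strongly_measurable M g"
  shows "strongly_measurable M (\<lambda>w. (f w, g w))"
proof -
  obtain s where s: "\<And>i. simple_function M (s i)" "\<And>w. w \<in> space M \<Longrightarrow> (\<lambda>i. s i w) \<longlonglongrightarrow> f w"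
    using assms(1) unfolding strongly_measurable_def by blast
  obtain t where t: "\<And>i. simple_function M (t i)" "\<And>w. w \<in> space M \<Longrightarrow> (\<lambda>i. t i w) \<longlonglongrightarrow> g w"
    using assms(2) unfolding strongly_measurable_def by blast
  show ?thesis
    unfolding strongly_measurable_def
    by (intro exI[of _ "\<lambda>i w. (s i w, t i w)"]) (auto intro!: tendsto_Pair simple_function_Pair s t)
qed

lemma strongly_measurable_add:
  "strongly_measurable M f \<Longrightarrow> strongly_measurable M g \<Longrightarrow> strongly_measurable M (\<lambda>w. f w + g w)"
  using strongly_measurable_compose[OF strongly_measurable_Pair, of M f g "\<lambda>p. fst p + snd p"]
  by (simp add: continuous_intros)

lemma strongly_measurable_simple: "simple_function M f \<Longrightarrow> strongly_measurable M f"
  unfolding strongly_measurable_def by (intro exI[of _ "\<lambda>_. f"]) auto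

lemma strongly_measurable_sum:
  assumes "\<And>k. k \<in> I \<Longrightarrow> strongly_measurable M (f k)"
  shows "strongly_measurable M (\<lambda>w. \<Sum>k\<in>I. f k w)"
  using assms
  by (induction I rule: infinite_finite_induct)
    (simp_all add: strongly_measurable_add strongly_measurable_simple)

lemma borel_measurable_norm_strongly:
  assumes "strongly_measurable M f"
  shows "(\<lambda>w. norm (f w)) \<in> borel_measurable M"
  using strongly_measurable_compose[OF assms, of norm]
  by (simp add: strongly_measurable_iff_borel_measurable continuous_intros)

lemma borel_measurable_norm_diff_simple:
  assumes "strongly_measurable M f" "Bochner_Integration.simple_bochner_integrable M s"
  shows "(\<lambda>w. norm (f w - s w)) \<in> borel_measurable M"
proof -
  have "strongly_measurable M s"
    using assms(2) by (auto intro: strongly_measurable_simple elim: simple_bochner_integrable.cases)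
  from strongly_measurable_compose[OF strongly_measurable_Pair[OF assms(1) this], of "\<lambda>p. norm (fst p - snd p)"]
  show ?thesis
    by (simp add: strongly_measurable_iff_borel_measurable continuous_intros)
qed

lemma has_strong_integralI:
  assumes "strongly_measurable M f" "\<And>i. Bochner_Integration.simple_bochner_integrable M (s i)"
    "(\<lambda>i. \<integral>\<^sup>+w. norm (f w - s i w) \<partial>M) \<longlonglongrightarrow> 0"
    "(\<lambda>i. Bochner_Integration.simple_bochner_integral M (s i)) \<longlonglongrightarrow> I"
  shows "has_strong_integral M f I"
  unfolding has_strong_integral_def using assms by blast

lemma tendsto_zero_ennreal_le:
  fixes a b :: "nat \<Rightarrow> ennreal"
  assumes "b \<longlonglongrightarrow> 0" "\<And>i. a i \<le> b i"
  shows "a \<longlonglongrightarrow> 0"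
  by (rule tendsto_sandwich[OF _ _ tendsto_const assms(1)]) (simp_all add: assms(2))

lemma has_strong_integral_cong:
  assumes "\<And>w. w \<in> space M \<Longrightarrow> f w = g w"
  shows "has_strong_integral M f I \<longleftrightarrow> has_strong_integral M g I"
proof -
  have "(\<integral>\<^sup>+w. norm (f w - s w) \<partial>M) = (\<integral>\<^sup>+w. norm (g w - s w) \<partial>M)" for s
    using assms by (intro nn_integral_cong) auto
  then show ?thesis
    using assms unfolding has_strong_integral_def strongly_measurable_def by simp
qed

text \<open>
  Linearity together with this bound gives uniqueness of the integral: two values differ by an integral of \<open>0\<close>.
\<close>

lemma has_strong_integral_norm_bound:
  assumes "has_strong_integral M f I"
  shows "ennreal (norm I) \<le> (\<integral>\<^sup>+w. norm (f w) \<partial>M)"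
proof -
  obtain s where m: "strongly_measurable M f"
    and s: "\<And>i. Bochner_Integration.simple_bochner_integrable M (s i)"
    and lim: "(\<lambda>i. \<integral>\<^sup>+w. norm (f w - s i w) \<partial>M) \<longlonglongrightarrow> 0"
    and int: "(\<lambda>i. Bochner_Integration.simple_bochner_integral M (s i)) \<longlonglongrightarrow> I"
    using assms unfolding has_strong_integral_def by blast
  have "ennreal (norm (Bochner_Integration.simple_bochner_integral M (s i)))
      \<le> (\<integral>\<^sup>+w. norm (f w) \<partial>M) + (\<integral>\<^sup>+w. norm (f w - s i w) \<partial>M)" for i
  proof -
    have sn: "Bochner_Integration.simple_bochner_integrable M (\<lambda>w. norm (s i w))"
      using simple_bochner_integrable_compose2[of "\<lambda>x y. norm x" M "s i" "s i"] s by simp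
    have "ennreal (norm (Bochner_Integration.simple_bochner_integral M (s i))) \<le> Bochner_Integration.simple_bochner_integral M (\<lambda>w. norm (s i w))"
      by (intro ennreal_leI simple_bochner_integral_norm_bound s)
    also have "\<dots> = (\<integral>\<^sup>+w. norm (s i w) \<partial>M)"
      by (intro simple_bochner_integral_eq_nn_integral sn) simp
    also have "\<dots> \<le> (\<integral>\<^sup>+w. ennreal (norm (f w)) + ennreal (norm (f w - s i w)) \<partial>M)"
      by (intro nn_integral_mono) (metis ennreal_leI ennreal_plus norm_ge_zero norm_minus_commute norm_triangle_sub)
    also have "\<dots> = (\<integral>\<^sup>+w. norm (f w) \<partial>M) + (\<integral>\<^sup>+w. norm (f w - s i w) \<partial>M)"
      using borel_measurable_norm_strongly[OF m] borel_measurable_norm_diff_simple[OF m s]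
      by (intro nn_integral_add) auto
    finally show ?thesis .
  qed
  then show ?thesis
    by (intro LIMSEQ_le[OF tendsto_ennrealI[OF tendsto_norm[OF int]]
          tendsto_add[OF tendsto_const lim, simplified add_0_right]]) auto
qed

lemma has_strong_integral_finite_norm:
  assumes "has_strong_integral M f I"
  shows "(\<integral>\<^sup>+w. norm (f w) \<partial>M) < \<infinity>"
proof -
  obtain s where m: "strongly_measurable M f"
    and s: "\<And>i. Bochner_Integration.simple_bochner_integrable M (s i)"
    and lim: "(\<lambda>i. \<integral>\<^sup>+w. norm (f w - s i w) \<partial>M) \<longlonglongrightarrow> 0"
    using assms unfolding has_strong_integral_def by blast
  have "\<forall>\<^sub>F i in sequentially. (\<integral>\<^sup>+w. norm (f w - s i w) \<partial>M) < 1"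
    by (rule order_tendstoD(2)[OF lim]) simp
  then obtain i where i: "(\<integral>\<^sup>+w. norm (f w - s i w) \<partial>M) < 1"
    using eventually_happens by fastforce
  have sn: "Bochner_Integration.simple_bochner_integrable M (\<lambda>w. norm (s i w))"
    using simple_bochner_integrable_compose2[of "\<lambda>x y. norm x" M "s i" "s i"] s by simp
  have sm: "(\<lambda>w. norm (s i w)) \<in> borel_measurable M"
    using sn by (auto intro: borel_measurable_simple_function elim: simple_bochner_integrable.cases)
  have "(\<integral>\<^sup>+w. norm (f w) \<partial>M) \<le> (\<integral>\<^sup>+w. ennreal (norm (s i w)) + ennreal (norm (f w - s i w)) \<partial>M)"
    by (intro nn_integral_mono) (simp add: ennreal_plus[symmetric] norm_triangle_sub del: ennreal_plus)
  also have "\<dots> = (\<integral>\<^sup>+w. norm (s i w) \<partial>M) + (\<integral>\<^sup>+w. norm (f w - s i w) \<partial>M)"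
    using sm borel_measurable_norm_diff_simple[OF m s]
    by (intro nn_integral_add) auto
  also have "\<dots> < \<infinity>"
  proof -
    have "(\<integral>\<^sup>+w. norm (s i w) \<partial>M) < \<infinity>"
      unfolding simple_bochner_integral_eq_nn_integral[OF sn norm_ge_zero, symmetric] by simp
    moreover have "(\<integral>\<^sup>+w. norm (f w - s i w) \<partial>M) < \<infinity>"
      using i by (rule less_trans) simp
    ultimately show ?thesis by simp
  qed
  finally show ?thesis .
qed

lemma has_strong_integral_add:
  assumes "has_strong_integral M f I" "has_strong_integral M g J"
  shows "has_strong_integral M (\<lambda>w. f w + g w) (I + J)"
proof -
  obtain s where f: "strongly_measurable M f"
    and s: "\<And>i. Bochner_Integration.simple_bochner_integrable M (s i)"
    and s_lim: "(\<lambda>i. \<integral>\<^sup>+w. norm (f w - s i w) \<partial>M) \<longlonglongrightarrow> 0"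
    and s_int: "(\<lambda>i. Bochner_Integration.simple_bochner_integral M (s i)) \<longlonglongrightarrow> I"
    using assms(1) unfolding has_strong_integral_def by blast
  obtain t where g: "strongly_measurable M g"
    and t: "\<And>i. Bochner_Integration.simple_bochner_integrable M (t i)"
    and t_lim: "(\<lambda>i. \<integral>\<^sup>+w. norm (g w - t i w) \<partial>M) \<longlonglongrightarrow> 0"
    and t_int: "(\<lambda>i. Bochner_Integration.simple_bochner_integral M (t i)) \<longlonglongrightarrow> J"
    using assms(2) unfolding has_strong_integral_def by blast
  have st: "Bochner_Integration.simple_bochner_integrable M (\<lambda>w. s i w + t i w)" for i
    by (rule simple_bochner_integrable_compose2[OF _ s t]) simp
  have "(\<integral>\<^sup>+w. norm (f w + g w - (s i w + t i w)) \<partial>M)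
      \<le> (\<integral>\<^sup>+w. norm (f w - s i w) \<partial>M) + (\<integral>\<^sup>+w. norm (g w - t i w) \<partial>M)" for i
  proof -
    have "(\<integral>\<^sup>+w. norm (f w + g w - (s i w + t i w)) \<partial>M)
      \<le> (\<integral>\<^sup>+w. ennreal (norm (f w - s i w)) + ennreal (norm (g w - t i w)) \<partial>M)"
      by (intro nn_integral_mono) (simp add: ennreal_plus[symmetric] norm_diff_triangle_ineq del: ennreal_plus)
    also have "\<dots> = (\<integral>\<^sup>+w. norm (f w - s i w) \<partial>M) + (\<integral>\<^sup>+w. norm (g w - t i w) \<partial>M)"
      using borel_measurable_norm_diff_simple[OF f s] borel_measurable_norm_diff_simple[OF g t]
      by (intro nn_integral_add) auto
    finally show ?thesis .
  qed
  from tendsto_zero_ennreal_le[OF tendsto_add[OF s_lim t_lim, simplified add_0_right] this]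
  have "(\<lambda>i. \<integral>\<^sup>+w. norm (f w + g w - (s i w + t i w)) \<partial>M) \<longlonglongrightarrow> 0" .
  moreover have "(\<lambda>i. Bochner_Integration.simple_bochner_integral M (\<lambda>w. s i w + t i w)) \<longlonglongrightarrow> I + J"
    unfolding simple_bochner_integral_add[OF s t] by (rule tendsto_add[OF s_int t_int])
  ultimately show ?thesis
    by (rule has_strong_integralI[OF strongly_measurable_add[OF f g] st])
qed

lemma has_strong_integral_bounded_linear:
  assumes L: "bounded_linear L" and f: "has_strong_integral M f I"
  shows "has_strong_integral M (\<lambda>w. L (f w)) (L I)"
proof -
  interpret L: bounded_linear L by fact
  obtain s where m: "strongly_measurable M f"
    and s: "\<And>i. Bochner_Integration.simple_bochner_integrable M (s i)"
    and lim: "(\<lambda>i. \<integral>\<^sup>+w. norm (f w - s i w) \<partial>M) \<longlonglongrightarrow> 0"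
    and int: "(\<lambda>i. Bochner_Integration.simple_bochner_integral M (s i)) \<longlonglongrightarrow> I"
    using f unfolding has_strong_integral_def by blast
  obtain K where K: "0 < K" "\<And>x. norm (L x) \<le> norm x * K"
    using L.pos_bounded by blast
  have "(\<integral>\<^sup>+w. norm (L (f w) - L (s i w)) \<partial>M) \<le> K * (\<integral>\<^sup>+w. norm (f w - s i w) \<partial>M)" for i
  proof -
    have "(\<integral>\<^sup>+w. norm (L (f w) - L (s i w)) \<partial>M) \<le> (\<integral>\<^sup>+w. ennreal K * norm (f w - s i w) \<partial>M)"
      using K by (intro nn_integral_mono) (simp add: L.diff[symmetric] ennreal_mult[symmetric] mult.commute)
    also have "\<dots> = K * (\<integral>\<^sup>+w. norm (f w - s i w) \<partial>M)"
      using borel_measurable_norm_diff_simple[OF m s] by (intro nn_integral_cmult) auto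
    finally show ?thesis .
  qed
  moreover have "(\<lambda>i. ennreal K * (\<integral>\<^sup>+w. norm (f w - s i w) \<partial>M)) \<longlonglongrightarrow> 0"
    using ennreal_tendsto_cmult[OF _ lim, of "ennreal K"] by simp
  ultimately have L_lim: "(\<lambda>i. \<integral>\<^sup>+w. norm (L (f w) - L (s i w)) \<partial>M) \<longlonglongrightarrow> 0"
    by (rule tendsto_zero_ennreal_le[rotated])
  have L_s: "Bochner_Integration.simple_bochner_integrable M (\<lambda>w. L (s i w))" for i
    using simple_bochner_integrable_compose2[of "\<lambda>x y. L x" M "s i" "s i"] s by (simp add: L.zero)
  have "(\<lambda>i. Bochner_Integration.simple_bochner_integral M (\<lambda>w. L (s i w))) \<longlonglongrightarrow> L I"
    unfolding simple_bochner_integral_linear[OF L.linear_axioms s] by (rule L.tendsto[OF int])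
  from has_strong_integralI[OF strongly_measurable_compose[OF m linear_continuous_on[OF L]] L_s L_lim this]
  show ?thesis .
qed

lemma has_strong_integral_diff:
  assumes "has_strong_integral M f I" "has_strong_integral M g J"
  shows "has_strong_integral M (\<lambda>w. f w - g w) (I - J)"
  using has_strong_integral_add[OF assms(1)
      has_strong_integral_bounded_linear[OF bounded_linear_minus[OF bounded_linear_ident] assms(2)]]
  by simp

lemma has_strong_integral_zero: "has_strong_integral M (\<lambda>w. 0) 0"
  unfolding has_strong_integral_def
proof (intro conjI exI[of _ "\<lambda>i w. 0"])
  show "strongly_measurable M (\<lambda>w. 0)" by (rule strongly_measurable_simple) simp
qed (auto simp: simple_bochner_integrable.simps simple_bochner_integral_def image_constant_conv)

lemma has_strong_integral_sum:
  assumes "\<And>k. k \<in> K \<Longrightarrow> has_strong_integral M (f k) (I k)"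
  shows "has_strong_integral M (\<lambda>w. \<Sum>k\<in>K. f k w) (\<Sum>k\<in>K. I k)"
  using assms
  by (induction K rule: infinite_finite_induct)
    (simp_all add: has_strong_integral_add has_strong_integral_zero)

lemma has_strong_integral_unique:
  assumes "has_strong_integral M f I" "has_strong_integral M f J"
  shows "I = J"
  using has_strong_integral_norm_bound[OF has_strong_integral_diff[OF assms]] by simp

lemma has_strong_integral_integral_iff:
  "has_strong_integral M f I \<longleftrightarrow> strong_integrable M f \<and> strong_integral M f = I"
proof -
  have "strong_integral M f = I" if "has_strong_integral M f I" for I
    using that the_equality[of "has_strong_integral M f" I, OF that has_strong_integral_unique[OF _ that]]
    by (auto simp: strong_integral_def strong_integrable_def)
  then show ?thesis unfolding strong_integrable_def by blast
qed

section \<open>Integrability criteria and positive integrands\<close>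

text \<open>
  Strong measurability supplies simple functions \<open>s\<^sub>i\<close> that converge pointwise to \<open>f\<close> but may be
  large. Cutting off where \<open>\<parallel>s\<^sub>i\<parallel> > 2 \<parallel>f\<parallel>\<close> keeps pointwise convergence and provides the integrable majorant
  that dominated convergence asks for; completeness then yields the limit of the integrals.
\<close>

lemma strong_integrableI_norm_finite:
  fixes f :: "'w \<Rightarrow> 'b::banach"
  assumes m: "strongly_measurable M f" and fin: "(\<integral>\<^sup>+w. norm (f w) \<partial>M) < \<infinity>"
  shows "strong_integrable M f"
proof -
  obtain s where s: "\<And>i. simple_function M (s i)" "\<And>w. w \<in> space M \<Longrightarrow> (\<lambda>i. s i w) \<longlonglongrightarrow> f w"
    using m unfolding strongly_measurable_def by blast
  define t where "t i w = (if norm (s i w) \<le> 2 * norm (f w) then s i w else 0)" for i w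
  note fm[measurable] = borel_measurable_norm_strongly[OF m]
  have [measurable]: "(\<lambda>w. norm (s i w)) \<in> borel_measurable M" for i
    by (intro borel_measurable_simple_function simple_function_compose1[OF s(1)])
  have t_simple: "simple_function M (t i)" for i
    unfolding t_def by (rule simple_function_If[OF s(1) simple_function_const]) measurable
  have t_bound: "norm (t i w) \<le> 2 * norm (f w)" for i w
    by (simp add: t_def)
  have t_int: "Bochner_Integration.simple_bochner_integrable M (t i)" for i
  proof (rule simple_bochner_integrableI_bounded[OF t_simple])
    have "(\<integral>\<^sup>+w. norm (t i w) \<partial>M) \<le> (\<integral>\<^sup>+w. 2 * ennreal (norm (f w)) \<partial>M)"
      using t_bound by (intro nn_integral_mono) (metis ennreal_leI ennreal_mult' ennreal_numeral zero_le_numeral)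
    also have "\<dots> < \<infinity>"
      using fin by (simp add: nn_integral_cmult ennreal_mult_less_top)
    finally show "(\<integral>\<^sup>+w. norm (t i w) \<partial>M) < \<infinity>" .
  qed
  have t_lim: "(\<lambda>i. t i w) \<longlonglongrightarrow> f w" if w: "w \<in> space M" for w
  proof (cases "f w = 0")
    case True
    then have "t i w = 0" for i by (simp add: t_def)
    then show ?thesis using True by simp
  next
    case False
    have "\<forall>\<^sub>F i in sequentially. norm (s i w) < 2 * norm (f w)"
      using False by (intro order_tendstoD(2)[OF tendsto_norm[OF s(2)[OF w]]]) simp
    then have "\<forall>\<^sub>F i in sequentially. s i w = t i w"
      by eventually_elim (simp add: t_def)
    from Lim_transform_eventually[OF s(2)[OF w] this] show ?thesis .
  qed
  have lim: "(\<lambda>i. \<integral>\<^sup>+w. norm (f w - t i w) \<partial>M) \<longlonglongrightarrow> 0"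
  proof -
    have "(\<lambda>i. \<integral>\<^sup>+w. norm (0 - norm (f w - t i w)) \<partial>M) \<longlonglongrightarrow> 0"
    proof (rule nn_integral_dominated_convergence_norm[where w = "\<lambda>w. 3 * norm (f w)"])
      show "AE w in M. norm (norm (f w - t i w)) \<le> 3 * norm (f w)" for i
      proof (rule AE_I2)
        show "norm (norm (f w - t i w)) \<le> 3 * norm (f w)" for w
          using norm_triangle_ineq4[of "f w" "t i w"] t_bound[of i w] by simp
      qed
      show "(\<integral>\<^sup>+w. ennreal (3 * norm (f w)) \<partial>M) < \<infinity>"
        using fin by (simp add: ennreal_mult nn_integral_cmult ennreal_mult_less_top)
      show "AE w in M. (\<lambda>i. norm (f w - t i w)) \<longlonglongrightarrow> 0"
        using tendsto_norm_zero[OF LIM_zero[OF t_lim]] by (intro AE_I2) (simp add: norm_minus_commute)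
    qed (use borel_measurable_norm_diff_simple[OF m t_int] in auto)
    then show ?thesis by simp
  qed
  have "Cauchy (\<lambda>i. Bochner_Integration.simple_bochner_integral M (t i))"
  proof (rule metric_CauchyI)
    fix e :: real assume e: "0 < e"
    have "\<forall>\<^sub>F i in sequentially. (\<integral>\<^sup>+w. norm (f w - t i w) \<partial>M) < ennreal (e / 2)"
      using e by (intro order_tendstoD(2)[OF lim]) simp
    then obtain N where N: "\<And>i. N \<le> i \<Longrightarrow> (\<integral>\<^sup>+w. norm (f w - t i w) \<partial>M) < ennreal (e / 2)"
      by (auto simp: eventually_sequentially)
    have "dist (Bochner_Integration.simple_bochner_integral M (t i)) (Bochner_Integration.simple_bochner_integral M (t j)) < e"
      if ij: "N \<le> i" "N \<le> j" for i j
    proof -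
      have d: "Bochner_Integration.simple_bochner_integrable M (\<lambda>w. t i w - t j w)"
        by (rule simple_bochner_integrable_compose2[OF _ t_int t_int]) simp
      have dn: "Bochner_Integration.simple_bochner_integrable M (\<lambda>w. norm (t i w - t j w))"
        by (rule simple_bochner_integrable_compose2[where p = "\<lambda>x y. norm (x - y)", OF _ t_int t_int]) simp
      have "ennreal (dist (Bochner_Integration.simple_bochner_integral M (t i)) (Bochner_Integration.simple_bochner_integral M (t j)))
        \<le> Bochner_Integration.simple_bochner_integral M (\<lambda>w. norm (t i w - t j w))"
        using simple_bochner_integral_norm_bound[OF d]
        by (simp add: dist_norm simple_bochner_integral_diff t_int ennreal_leI)
      also have "\<dots> = (\<integral>\<^sup>+w. norm (t i w - t j w) \<partial>M)"
        by (intro simple_bochner_integral_eq_nn_integral dn) simp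
      also have "\<dots> \<le> (\<integral>\<^sup>+w. ennreal (norm (f w - t i w)) + ennreal (norm (f w - t j w)) \<partial>M)"
        by (intro nn_integral_mono)
          (metis dist_norm dist_triangle3 ennreal_leI ennreal_plus norm_ge_zero)
      also have "\<dots> = (\<integral>\<^sup>+w. norm (f w - t i w) \<partial>M) + (\<integral>\<^sup>+w. norm (f w - t j w) \<partial>M)"
        using borel_measurable_norm_diff_simple[OF m t_int] by (intro nn_integral_add) auto
      also have "\<dots> < ennreal (e / 2) + ennreal (e / 2)"
        by (intro add_strict_mono N ij)
      also have "\<dots> = ennreal e" using e by (simp add: ennreal_plus[symmetric] del: ennreal_plus)
      finally show ?thesis by (simp add: ennreal_less_iff)
    qed
    then show "\<exists>N. \<forall>i\<ge>N. \<forall>j\<ge>N. dist (Bochner_Integration.simple_bochner_integral M (t i)) (Bochner_Integration.simple_bochner_integral M (t j)) < e"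
      by blast
  qed
  then obtain I where "(\<lambda>i. Bochner_Integration.simple_bochner_integral M (t i)) \<longlonglongrightarrow> I"
    using Cauchy_convergent convergent_def by blast
  then show ?thesis
    unfolding strong_integrable_def has_strong_integral_def using m t_int lim by blast
qed

text \<open>
  Positivity passes to the integral through norms. With \<open>t = \<integral> \<parallel>f\<parallel>\<close>,
  \<open>\<parallel>t - I\<parallel> = \<parallel>\<integral> (\<parallel>f\<parallel> - f)\<parallel> \<le> \<integral> \<parallel>\<parallel>f\<parallel> - f\<parallel> \<le> \<integral> \<parallel>f\<parallel> = t\<close>, using the norm characterisation of
  positivity pointwise and then for \<open>I\<close>.
\<close>

lemma has_strong_integral_positive:
  fixes f :: "'w \<Rightarrow> 'a::cstar_algebra"
  assumes f: "has_strong_integral M f I" and pos: "\<And>w. w \<in> space M \<Longrightarrow> cstar_positive (f w)"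
  shows "cstar_positive I"
proof -
  have m: "strongly_measurable M f" using f by (simp add: has_strong_integral_def)
  have int: "integrable M (\<lambda>w. norm (f w))"
    using has_strong_integral_finite_norm[OF f] borel_measurable_norm_strongly[OF m]
    by (intro integrableI_bounded) auto
  define t where "t = (\<integral>w. norm (f w) \<partial>M)"
  have nn: "(\<integral>\<^sup>+w. norm (f w) \<partial>M) = ennreal t"
    unfolding t_def by (rule nn_integral_eq_integral[OF int]) simp
  have t: "0 \<le> t" by (simp add: t_def)
  have "has_strong_integral M (\<lambda>w. norm (f w)) t"
    unfolding has_strong_integral_iff_has_bochner_integral t_def
    by (rule has_bochner_integral_integrable[OF int])
  from has_strong_integral_diff[OF has_strong_integral_bounded_linear[OF bounded_linear_scaleR_left this] f]
  have "has_strong_integral M (\<lambda>w. norm (f w) *\<^sub>R 1 - f w) (t *\<^sub>R 1 - I)" .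
  from has_strong_integral_norm_bound[OF this]
  have "ennreal (norm (t *\<^sub>R 1 - I)) \<le> (\<integral>\<^sup>+w. norm (norm (f w) *\<^sub>R 1 - f w) \<partial>M)" .
  also have "\<dots> \<le> (\<integral>\<^sup>+w. norm (f w) \<partial>M)"
    by (intro nn_integral_mono ennreal_leI cstar_positive_imp_norm[OF pos order_refl])
  finally have "norm (t *\<^sub>R 1 - I) \<le> t" using t by (simp add: nn)
  moreover have "star I = I"
  proof (rule has_strong_integral_unique)
    show "has_strong_integral M (\<lambda>w. star (f w)) (star I)"
      by (rule has_strong_integral_bounded_linear[OF bounded_linear_star f])
    show "has_strong_integral M (\<lambda>w. star (f w)) I"
      using f has_strong_integral_cong[of M "\<lambda>w. star (f w)" f I] pos by (simp add: cstar_positive_def)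
  qed
  ultimately show ?thesis by (rule cstar_positive_if_norm[rotated])
qed

lemma has_strong_integral_mono:
  fixes f g :: "'w \<Rightarrow> 'a::cstar_algebra"
  assumes "has_strong_integral M f I" "has_strong_integral M g J" "\<And>w. w \<in> space M \<Longrightarrow> f w \<sqsubseteq> g w"
  shows "I \<sqsubseteq> J"
  using has_strong_integral_positive[OF has_strong_integral_diff[OF assms(2,1)]] assms(3)
  by (simp add: cstar_le_def)

lemma cstar_le_scaleR: "a \<sqsubseteq> b \<Longrightarrow> 0 \<le> r \<Longrightarrow> r *\<^sub>R a \<sqsubseteq> r *\<^sub>R (b::'a::cstar_algebra)"
  unfolding cstar_le_def using cstar_positive_scaleR[of "b - a" r] by (simp add: scaleR_diff_right)

lemma cstar_le_scaleR_left:
  "cstar_positive a \<Longrightarrow> r \<le> s \<Longrightarrow> r *\<^sub>R a \<sqsubseteq> s *\<^sub>R (a::'a::cstar_algebra)"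
  unfolding cstar_le_def using cstar_positive_scaleR[of a "s - r"] by (simp add: scaleR_diff_left)

lemma cstar_le_sum:
  "(\<And>i. i \<in> I \<Longrightarrow> f i \<sqsubseteq> g i) \<Longrightarrow> (\<Sum>i\<in>I. f i) \<sqsubseteq> (\<Sum>i\<in>I. g i)"
  unfolding cstar_le_def using cstar_positive_sum[of I "\<lambda>i. g i - f i"] by (simp add: sum_subtractf)

lemma strong_integrable_dominated:
  fixes f g :: "'w \<Rightarrow> 'a::cstar_algebra"
  assumes f: "strongly_measurable M f" and g: "has_strong_integral M g J"
    and pos: "\<And>w. w \<in> space M \<Longrightarrow> cstar_positive (f w)"
    and le: "\<And>w. w \<in> space M \<Longrightarrow> f w \<sqsubseteq> g w"
  shows "strong_integrable M f"
proof (rule strong_integrableI_norm_finite[OF f])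
  have "(\<integral>\<^sup>+w. norm (f w) \<partial>M) \<le> (\<integral>\<^sup>+w. norm (g w) \<partial>M)"
    by (intro nn_integral_mono ennreal_leI cstar_norm_mono pos le)
  also have "\<dots> < \<infinity>" by (rule has_strong_integral_finite_norm[OF g])
  finally show "(\<integral>\<^sup>+w. norm (f w) \<partial>M) < \<infinity>" .
qed

section \<open>Hilbert modules and adjointable maps\<close>

context hilbert_module
begin

lemma ip_add_right: "ip x (y + z) = ip x y + ip x z"
  by (metis ip_add_left ip_star star_add)

lemma ip_diff_left: "ip (x - y) z = ip x z - ip y z"
  using ip_add_left[of "x - y" y z] by simp

lemma ip_diff_right: "ip x (y - z) = ip x y - ip x z"
  using ip_add_right[of x "y - z" z] by simp

lemma ip_sm_right: "ip x (sm a y) = ip x y * star a"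
  by (metis ip_sm_left ip_star star_mult)

lemma scaleR_eq_sm: "r *\<^sub>R x = sm (r *\<^sub>R 1) x"
  by (simp add: sm_scaleR sm_one)

lemma ip_scaleR_left: "ip (r *\<^sub>R x) y = r *\<^sub>R ip x y"
  by (simp add: scaleR_eq_sm ip_sm_left)

lemma ip_scaleR_right: "ip x (r *\<^sub>R y) = r *\<^sub>R ip x y"
  by (simp add: scaleR_eq_sm ip_sm_right star_scaleR star_one)

lemma norm_ip_self: "norm (ip x x) = (norm x)\<^sup>2"
  by (simp add: norm_eq_ip)

lemma ip_module_scaleC_left: "ip (module_scaleC sm c x) y = scaleC c (ip x y)"
  by (simp add: module_scaleC_def ip_sm_left mult_scaleC_left)

lemma ip_module_scaleC_right: "ip x (module_scaleC sm c y) = scaleC (cnj c) (ip x y)"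
  by (simp add: module_scaleC_def ip_sm_right star_scaleC star_one mult_scaleC_right)

lemma ip_module_scaleC_self:
  "ip (module_scaleC sm c x) (module_scaleC sm c x) = (cmod c)\<^sup>2 *\<^sub>R ip x x"
proof -
  have "cnj c * c = complex_of_real ((cmod c)\<^sup>2)"
    by (simp only: complex_norm_square mult.commute)
  then show ?thesis
    by (simp only: ip_module_scaleC_left ip_module_scaleC_right scaleC_scaleC mult.commute[of c]
        scaleC_of_real)
qed

lemma norm_module_scaleC: "norm (module_scaleC sm c x) = cmod c * norm x"
  unfolding norm_eq_ip ip_module_scaleC_self by (simp add: real_sqrt_mult)

lemma bounded_linear_module_scaleC: "bounded_linear (module_scaleC sm c)"
proof (rule bounded_linear_intro)
  show "module_scaleC sm c (x + y) = module_scaleC sm c x + module_scaleC sm c y" for x y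
    by (simp add: module_scaleC_def sm_add_right)
  show "module_scaleC sm c (r *\<^sub>R x) = r *\<^sub>R module_scaleC sm c x" for r x
    by (simp add: module_scaleC_def scaleR_eq_sm sm_sm)
  show "norm (module_scaleC sm c x) \<le> norm x * cmod c" for x
    by (simp add: norm_module_scaleC)
qed

lemma ip_polarization:
  fixes x y :: 'h
  defines "N \<equiv> \<lambda>u. ip u u" and "z \<equiv> module_scaleC sm \<i> y"
  shows "4 *\<^sub>R ip x y = N (x + y) - N (x - y) + scaleC \<i> (N (x + z) - N (x - z))"
proof -
  have E: "N (x + u) - N (x - u) = 2 *\<^sub>R (ip x u + ip u x)" for u
    by (simp add: N_def ip_add_left ip_add_right ip_diff_left ip_diff_right scaleR_2 algebra_simps)
  have I: "scaleC \<i> (2 *\<^sub>R (ip x z + ip z x)) = 2 *\<^sub>R (ip x y - ip y x)"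
    by (simp add: z_def ip_module_scaleC_left ip_module_scaleC_right scaleC_add_right
        scaleC_scaleR scaleR_scaleC[symmetric] scaleC_scaleC scaleC_minus_left scaleC_one
        scaleR_2 scaleC_diff_right)
  have "2 *\<^sub>R (ip x y + ip y x) + 2 *\<^sub>R (ip x y - ip y x) = (2 + 2) *\<^sub>R ip x y"
    by (simp only: scaleR_add_left scaleR_add_right scaleR_diff_right) simp
  then show ?thesis
    unfolding E I by simp
qed

text \<open>
  A Cauchy-Schwarz inequality with a non-optimal constant suffices, since it serves only to make the
  inner product continuous. Polarisation expresses \<open>4 \<langle>u,v\<rangle>\<close> for unit vectors by four terms
  \<open>\<langle>d,d\<rangle>\<close> with \<open>\<parallel>d\<parallel> \<le> 2\<close>.
\<close>

lemma norm_ip_le: "norm (ip x y) \<le> norm x * norm y * 4"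
proof (cases "x = 0 \<or> y = 0")
  case True
  then show ?thesis using ip_scaleR_left[of 0 0 y] ip_scaleR_right[of x 0 0] by auto
next
  case False
  have unit: "norm (ip u v) \<le> 4" if u: "norm u = 1" and v: "norm v = 1" for u v
  proof -
    have N: "norm (ip d d) \<le> 4" if "d = u + b \<or> d = u - b" "norm b = 1" for d b
    proof -
      have "norm d \<le> 2"
        using norm_triangle_ineq[of u b] norm_triangle_ineq4[of u b] u that by auto
      then have "(norm d)\<^sup>2 \<le> 2\<^sup>2" by (rule power_mono) simp
      then show ?thesis by (simp add: norm_ip_self)
    qed
    have D: "norm (ip (u + b) (u + b) - ip (u - b) (u - b)) \<le> 8" if "norm b = 1" for b
      using norm_triangle_ineq4[of "ip (u + b) (u + b)" "ip (u - b) (u - b)"]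
        N[of "u + b" b] N[of "u - b" b] that by simp
    let ?z = "module_scaleC sm \<i> v"
    have "4 * norm (ip u v) = norm (4 *\<^sub>R ip u v)" by simp
    also have "\<dots> \<le> 8 + 8"
      unfolding ip_polarization
      using D[OF v] D[of ?z] v by (intro norm_triangle_mono) (simp_all add: norm_scaleC norm_module_scaleC)
    finally show ?thesis by simp
  qed
  have "x = norm x *\<^sub>R sgn x" "y = norm y *\<^sub>R sgn y"
    using False by (simp_all add: sgn_div_norm)
  then have "norm (ip x y) = norm x * norm y * norm (ip (sgn x) (sgn y))"
    by (metis abs_norm_cancel ip_scaleR_left ip_scaleR_right mult.assoc norm_scaleR)
  also have "\<dots> \<le> norm x * norm y * 4"
    using False by (intro mult_left_mono unit) (simp_all add: norm_sgn)
  finally show ?thesis .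
qed

lemma bounded_bilinear_ip: "bounded_bilinear ip"
  by unfold_locales
    (auto simp: ip_add_left ip_add_right ip_scaleR_left ip_scaleR_right
      intro: exI[of _ 4] norm_ip_le)

lemma strongly_measurable_ip_self:
  assumes "strongly_measurable M X"
  shows "strongly_measurable M (\<lambda>w. ip (X w) (X w))"
  by (intro strongly_measurable_compose[OF assms, of "\<lambda>x. ip x x"]
      bounded_bilinear.continuous_on[OF bounded_bilinear_ip] continuous_on_id)

text \<open>
  The difference of the two sides is \<open>n\<close> times \<open>\<Sum>\<^sub>k \<langle>u\<^sub>k - s/n, u\<^sub>k - s/n\<rangle>\<close>, where \<open>s = \<Sum>\<^sub>k u\<^sub>k\<close> and \<open>n\<close> is
  the number of terms.
\<close>

lemma ip_sum_self_le:
  assumes K: "finite K" "K \<noteq> {}"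
  shows "ip (\<Sum>k\<in>K. u k) (\<Sum>k\<in>K. u k) \<sqsubseteq> real (card K) *\<^sub>R (\<Sum>k\<in>K. ip (u k) (u k))"
proof -
  interpret ip: bounded_bilinear ip by (rule bounded_bilinear_ip)
  define s where "s = (\<Sum>k\<in>K. u k)"
  define r where "r = 1 / real (card K)"
  have n: "real (card K) \<noteq> 0" using K by simp
  have "(\<Sum>k\<in>K. ip (u k - r *\<^sub>R s) (u k - r *\<^sub>R s))
      = (\<Sum>k\<in>K. ip (u k) (u k)) - r *\<^sub>R ip s s - r *\<^sub>R ip s s + real (card K) *\<^sub>R (r * r) *\<^sub>R ip s s"
    unfolding s_def[symmetric]
    by (simp add: ip.diff_left ip.diff_right ip.scaleR_left ip.scaleR_right sum_subtractf sum.distrib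
        scaleR_sum_right[symmetric] ip.sum_left[symmetric] ip.sum_right[symmetric] s_def[symmetric]
        sum_constant_scaleR algebra_simps del: sum_constant)
  also have "\<dots> = (\<Sum>k\<in>K. ip (u k) (u k)) - r *\<^sub>R ip s s"
    using n by (simp add: r_def)
  finally have "real (card K) *\<^sub>R (\<Sum>k\<in>K. ip (u k - r *\<^sub>R s) (u k - r *\<^sub>R s))
      = real (card K) *\<^sub>R (\<Sum>k\<in>K. ip (u k) (u k)) - ip s s"
    using n by (simp add: scaleR_diff_right r_def)
  moreover have "cstar_positive (real (card K) *\<^sub>R (\<Sum>k\<in>K. ip (u k - r *\<^sub>R s) (u k - r *\<^sub>R s)))"
    by (intro cstar_positive_scaleR cstar_positive_sum ip_positive) simp
  ultimately show ?thesis by (simp add: cstar_le_def s_def)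
qed

lemma adjointable_module_linear:
  assumes "adjointable ip S"
  shows "S (sm a x) = sm a (S x)"
proof -
  interpret ip: bounded_bilinear ip by (rule bounded_bilinear_ip)
  obtain S' where S': "\<And>x y. ip (S x) y = ip x (S' y)"
    using assms by (auto simp: adjointable_def)
  have "ip (S (sm a x) - sm a (S x)) z = 0" for z
    by (simp add: ip.diff_left S' ip_sm_left)
  then show ?thesis using ip_definite by fastforce
qed

lemma adjointable_linear_combination:
  assumes "\<And>k. k \<in> K \<Longrightarrow> adjointable ip (S k)"
  shows "adjointable ip (\<lambda>x. \<Sum>k\<in>K. module_scaleC sm (\<alpha> k) (S k x))"
proof -
  interpret ip: bounded_bilinear ip by (rule bounded_bilinear_ip)
  obtain S' where S': "\<And>k x y. k \<in> K \<Longrightarrow> ip (S k x) y = ip x (S' k y)"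
    using assms unfolding adjointable_def by metis
  show ?thesis
    unfolding adjointable_def
    by (intro exI[of _ "\<lambda>y. \<Sum>k\<in>K. module_scaleC sm (cnj (\<alpha> k)) (S' k y)"])
      (simp add: ip.sum_left ip.sum_right ip_module_scaleC_left ip_module_scaleC_right S')
qed

section \<open>Frames and their linear combinations\<close>

text \<open>
  Replacing \<open>x\<close> by \<open>a x\<close> turns the norm estimate into one that is stable under conjugation,
  because \<open>\<langle>a x, a x\<rangle> = a \<langle>x,x\<rangle> a\<^sup>*\<close> and, by module linearity of \<open>S\<^sub>w\<close>, \<open>G (a x) = a (G x) a\<^sup>*\<close>.
\<close>

lemma frame_lower_bound_if_norm_lower_bound:
  assumes adj: "\<And>w. w \<in> space M \<Longrightarrow> adjointable ip (S w)"
    and int: "\<And>x. has_strong_integral M (\<lambda>w. ip (S w x) (S w x)) (G x)"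
    and c: "0 \<le> c" and le: "\<And>x. norm (ip x x) \<le> c * norm (G x)"
  shows "ip x x \<sqsubseteq> c *\<^sub>R G x"
proof (rule cstar_le_if_conjugate_norms_le[OF _ _ c])
  show "star (ip x x) = ip x x" by (rule ip_star)
  show "cstar_positive (G x)" by (rule has_strong_integral_positive[OF int ip_positive])
  fix a :: 'a
  have "bounded_linear (\<lambda>u. a * u * star a)"
    by (rule bounded_linear_compose[OF bounded_linear_mult_left bounded_linear_mult_right])
  from has_strong_integral_bounded_linear[OF this int]
  have "has_strong_integral M (\<lambda>w. ip (S w (sm a x)) (S w (sm a x))) (a * G x * star a)"
    by (subst has_strong_integral_cong[where g = "\<lambda>w. a * ip (S w x) (S w x) * star a"])
      (simp_all add: adjointable_module_linear[OF adj] ip_sm_left ip_sm_right mult.assoc)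
  then have "G (sm a x) = a * G x * star a"
    by (rule has_strong_integral_unique[OF int])
  with le[of "sm a x"] show "norm (a * ip x x * star a) \<le> c * norm (a * G x * star a)"
    by (simp add: ip_sm_left ip_sm_right mult.assoc)
qed

text \<open>
  All three claims follow from the pointwise majorant
  \<open>\<langle>S\<^sub>w x, S\<^sub>w x\<rangle> \<le> n \<Sum>\<^sub>k \<bar>\<alpha>\<^sub>k\<bar>\<^sup>2 \<langle>T\<^sub>k\<^sub>,\<^sub>w x, T\<^sub>k\<^sub>,\<^sub>w x\<rangle>\<close>, whose integral exists and is controlled by the
  upper frame bounds.
\<close>

lemma linear_combination_frames:
  fixes T :: "'k \<Rightarrow> 'w \<Rightarrow> 'h \<Rightarrow> 'h" and \<alpha> :: "'k \<Rightarrow> complex"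
  assumes K: "finite K" "K \<noteq> {}"
    and frame: "\<And>k. k \<in> K \<Longrightarrow> continuous_operator_frame_bounds M ip (T k) (A k) (B k)"
  defines "S \<equiv> \<lambda>w x. \<Sum>k\<in>K. module_scaleC sm (\<alpha> k) (T k w x)"
  shows linear_combination_measurable: "strongly_measurable M (\<lambda>w. S w x)"
    and linear_combination_integrable: "strong_integrable M (\<lambda>w. ip (S w x) (S w x))"
    and linear_combination_upper_bound: "strong_integral M (\<lambda>w. ip (S w x) (S w x))
      \<sqsubseteq> (real (card K) * (\<Sum>k\<in>K. (cmod (\<alpha> k))\<^sup>2 * B k)) *\<^sub>R ip x x"
proof -
  define G where "G k = strong_integral M (\<lambda>w. ip (T k w x) (T k w x))" for k
  have G: "has_strong_integral M (\<lambda>w. ip (T k w x) (T k w x)) (G k)"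
    and GB: "G k \<sqsubseteq> B k *\<^sub>R ip x x" and T: "strongly_measurable M (\<lambda>w. T k w x)" if "k \<in> K" for k
    using frame[OF that]
    by (simp_all add: continuous_operator_frame_bounds_def has_strong_integral_integral_iff G_def)
  show S: "strongly_measurable M (\<lambda>w. S w x)"
    unfolding S_def
    by (intro strongly_measurable_sum strongly_measurable_compose[OF T]
        linear_continuous_on bounded_linear_module_scaleC)
  define H where "H w = real (card K) *\<^sub>R (\<Sum>k\<in>K. (cmod (\<alpha> k))\<^sup>2 *\<^sub>R ip (T k w x) (T k w x))" for w
  have H: "has_strong_integral M H (real (card K) *\<^sub>R (\<Sum>k\<in>K. (cmod (\<alpha> k))\<^sup>2 *\<^sub>R G k))"
    unfolding H_def
    by (intro has_strong_integral_bounded_linear[OF bounded_linear_scaleR_right]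
        has_strong_integral_sum G)
  have SH: "ip (S w x) (S w x) \<sqsubseteq> H w" for w
    using ip_sum_self_le[OF K, of "\<lambda>k. module_scaleC sm (\<alpha> k) (T k w x)"]
    by (simp add: S_def H_def ip_module_scaleC_self)
  show int: "strong_integrable M (\<lambda>w. ip (S w x) (S w x))"
    by (rule strong_integrable_dominated[OF strongly_measurable_ip_self[OF S] H ip_positive SH])
  then have 1: "strong_integral M (\<lambda>w. ip (S w x) (S w x)) \<sqsubseteq> real (card K) *\<^sub>R (\<Sum>k\<in>K. (cmod (\<alpha> k))\<^sup>2 *\<^sub>R G k)"
    using has_strong_integral_mono[OF _ H SH] by (simp add: has_strong_integral_integral_iff)
  have 2: "real (card K) *\<^sub>R (\<Sum>k\<in>K. (cmod (\<alpha> k))\<^sup>2 *\<^sub>R G k) \<sqsubseteq> real (card K) *\<^sub>R (\<Sum>k\<in>K. (cmod (\<alpha> k))\<^sup>2 *\<^sub>R (B k *\<^sub>R ip x x))"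
    by (intro cstar_le_scaleR cstar_le_sum GB) simp_all
  have 3: "real (card K) *\<^sub>R (\<Sum>k\<in>K. (cmod (\<alpha> k))\<^sup>2 *\<^sub>R (B k *\<^sub>R ip x x))
      = (real (card K) * (\<Sum>k\<in>K. (cmod (\<alpha> k))\<^sup>2 * B k)) *\<^sub>R ip x x"
    by (simp only: scaleR_scaleR scaleR_sum_left[symmetric])
  show "strong_integral M (\<lambda>w. ip (S w x) (S w x))
      \<sqsubseteq> (real (card K) * (\<Sum>k\<in>K. (cmod (\<alpha> k))\<^sup>2 * B k)) *\<^sub>R ip x x"
    using cstar_le_trans[OF 1 2] unfolding 3 .
qed

lemma frame_norm_bounds:
  assumes "continuous_operator_frame_bounds M ip T A B"
  shows "A * norm (ip x x) \<le> (family_norm M ip (\<lambda>w. T w x))\<^sup>2"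
    and "(family_norm M ip (\<lambda>w. T w x))\<^sup>2 \<le> B * norm (ip x x)"
proof -
  define G where "G = strong_integral M (\<lambda>w. ip (T w x) (T w x))"
  have pos: "0 < A" "0 < B" and AG: "A *\<^sub>R ip x x \<sqsubseteq> G" and GB: "G \<sqsubseteq> B *\<^sub>R ip x x"
    and G: "has_strong_integral M (\<lambda>w. ip (T w x) (T w x)) G"
    using assms
    by (simp_all add: continuous_operator_frame_bounds_def has_strong_integral_integral_iff G_def)
  have N: "(family_norm M ip (\<lambda>w. T w x))\<^sup>2 = norm G"
    by (simp add: family_norm_def G_def)
  show "A * norm (ip x x) \<le> (family_norm M ip (\<lambda>w. T w x))\<^sup>2"
    using cstar_norm_mono[OF _ AG] cstar_positive_scaleR[OF ip_positive, of A x] pos by (simp add: N)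
  show "(family_norm M ip (\<lambda>w. T w x))\<^sup>2 \<le> B * norm (ip x x)"
    using cstar_norm_mono[OF has_strong_integral_positive[OF G ip_positive] GB] pos by (simp add: N)
qed

end

theorem theorem3p3:
  fixes M :: "'w measure"
    and sm :: "'a::cstar_algebra \<Rightarrow> 'h::banach \<Rightarrow> 'h"
    and ip :: "'h \<Rightarrow> 'h \<Rightarrow> 'a"
    and n :: nat
    and T :: "nat \<Rightarrow> 'w \<Rightarrow> 'h \<Rightarrow> 'h"
    and A B :: "nat \<Rightarrow> real"
    and \<alpha> :: "nat \<Rightarrow> complex"
  assumes "hilbert_module sm ip"
    and "n \<ge> 1"
    and "\<And>k. k \<in> {1..n} \<Longrightarrow> continuous_operator_frame_bounds M ip (T k) (A k) (B k)"
  shows "(\<exists>lam>0. \<exists>p\<in>{1..n}. \<forall>x.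
            lam * family_norm M ip (\<lambda>w. T p w x)
              \<le> family_norm M ip (\<lambda>w. \<Sum>k=1..n. module_scaleC sm (\<alpha> k) (T k w x)))
         \<longleftrightarrow> continuous_operator_frame M ip (\<lambda>w x. \<Sum>k=1..n. module_scaleC sm (\<alpha> k) (T k w x))"
proof -
  interpret hilbert_module sm ip by fact
  define S where "S w x = (\<Sum>k=1..n. module_scaleC sm (\<alpha> k) (T k w x))" for w x
  have K: "finite {1..n}" "{1..n} \<noteq> {}" using \<open>n \<ge> 1\<close> by auto
  note combination = linear_combination_frames
    [where T = T and A = A and B = B and \<alpha> = \<alpha>, OF K assms(3), folded S_def, simplified]
  have adj: "adjointable ip (S w)" if "w \<in> space M" for w
    unfolding S_def using assms(3) that
    by (intro adjointable_linear_combination) (auto simp: continuous_operator_frame_bounds_def)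
  define G where "G x = strong_integral M (\<lambda>w. ip (S w x) (S w x))" for x
  have G: "has_strong_integral M (\<lambda>w. ip (S w x) (S w x)) (G x)" for x
    using combination(2) by (simp add: has_strong_integral_integral_iff G_def)
  have fam_nonneg: "0 \<le> family_norm M ip X" for X
    by (simp add: family_norm_def)
  have fam_S: "(family_norm M ip (\<lambda>w. S w x))\<^sup>2 = norm (G x)" for x
    by (simp add: family_norm_def G_def)
  have "continuous_operator_frame M ip S"
    if lam: "0 < lam" and p: "p \<in> {1..n}"
      and le: "\<And>x. lam * family_norm M ip (\<lambda>w. T p w x) \<le> family_norm M ip (\<lambda>w. S w x)" for lam p
  proof -
    have A: "0 < A p" using assms(3)[OF p] by (simp add: continuous_operator_frame_bounds_def)
    define c where "c = 1 / (lam\<^sup>2 * A p)"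
    have c: "0 < c" using lam A by (simp add: c_def)
    have "norm (ip x x) \<le> c * norm (G x)" for x
    proof -
      have "lam\<^sup>2 * (A p * norm (ip x x)) \<le> lam\<^sup>2 * (family_norm M ip (\<lambda>w. T p w x))\<^sup>2"
        by (intro mult_left_mono frame_norm_bounds(1)[OF assms(3)[OF p]]) simp
      also have "\<dots> \<le> (family_norm M ip (\<lambda>w. S w x))\<^sup>2"
        unfolding power_mult_distrib[symmetric]
        using lam by (intro power_mono le mult_nonneg_nonneg fam_nonneg) simp
      finally show ?thesis
        using lam A by (simp add: fam_S c_def field_simps)
    qed
    then have "ip x x \<sqsubseteq> c *\<^sub>R G x" for x
      using frame_lower_bound_if_norm_lower_bound[OF adj G, of c] c by simp
    then have lower: "(1 / c) *\<^sub>R ip x x \<sqsubseteq> G x" for x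
      using cstar_le_scaleR[of "ip x x" "c *\<^sub>R G x" "1 / c"] c by simp
    \<comment> \<open>\<open>b\<close> vanishes if all coefficients do, hence the upper bound \<open>b + 1\<close>.\<close>
    define b where "b = real n * (\<Sum>k=1..n. (cmod (\<alpha> k))\<^sup>2 * B k)"
    have "0 \<le> b"
      unfolding b_def using assms(3)
      by (intro mult_nonneg_nonneg sum_nonneg) (auto simp: continuous_operator_frame_bounds_def less_imp_le)
    have "G x \<sqsubseteq> b *\<^sub>R ip x x" for x
      using combination(3)[of x] by (simp add: G_def b_def)
    then have "G x \<sqsubseteq> (b + 1) *\<^sub>R ip x x" for x
      using cstar_le_trans cstar_le_scaleR_left[OF ip_positive[of x], of b "b + 1"] by fastforce
    then have "continuous_operator_frame_bounds M ip S (1 / c) (b + 1)"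
      unfolding continuous_operator_frame_bounds_def G_def[symmetric]
      using c \<open>0 \<le> b\<close> adj combination(1,2) lower by simp
    then show ?thesis unfolding continuous_operator_frame_def by blast
  qed
  moreover have "\<exists>lam>0. \<exists>p\<in>{1..n}. \<forall>x.
      lam * family_norm M ip (\<lambda>w. T p w x) \<le> family_norm M ip (\<lambda>w. S w x)"
    if frame: "continuous_operator_frame M ip S"
  proof -
    obtain a b where ab: "continuous_operator_frame_bounds M ip S a b"
      using frame unfolding continuous_operator_frame_def by blast
    then have a: "0 < a" by (simp add: continuous_operator_frame_bounds_def)
    have one: "1 \<in> {1..n}" using \<open>n \<ge> 1\<close> by simp
    have B: "0 < B 1" using assms(3)[OF one] by (simp add: continuous_operator_frame_bounds_def)
    have "sqrt (a / B 1) * family_norm M ip (\<lambda>w. T 1 w x) \<le> family_norm M ip (\<lambda>w. S w x)" for x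
    proof (rule power2_le_imp_le[OF _ fam_nonneg])
      have "(a / B 1) * (family_norm M ip (\<lambda>w. T 1 w x))\<^sup>2 \<le> (a / B 1) * (B 1 * norm (ip x x))"
        using a B by (intro mult_left_mono frame_norm_bounds(2)[OF assms(3)[OF one]]) simp
      also have "\<dots> = a * norm (ip x x)" using B by simp
      also have "\<dots> \<le> (family_norm M ip (\<lambda>w. S w x))\<^sup>2"
        by (rule frame_norm_bounds(1)[OF ab])
      finally show "(sqrt (a / B 1) * family_norm M ip (\<lambda>w. T 1 w x))\<^sup>2 \<le> (family_norm M ip (\<lambda>w. S w x))\<^sup>2"
        using a B by (simp add: power_mult_distrib)
    qed
    then show ?thesis
      using a B one by (metis divide_pos_pos real_sqrt_gt_zero)
  qed
  ultimately show ?thesis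
    unfolding S_def[symmetric] by blast
qed

end
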